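(* Assume that $\alpha > 2$. For the continuous-space birth process $(\eta_t)_{t\ge 0}$ on $\mathbb{R}$ with birth rate $b(x,\eta) = 1\wedge \big(\sum_{y\in\eta} a(x-y)\big)$, where $a(z) = c_\alpha (1+|z|^2)^{-\alpha}$, and with initial condition $\eta_0 = \{0\}$, there exists a constant $\mathrm{C}_\alpha > 0$ such that almost surely, for all sufficiently large $t$, $$\eta_t \subset [-\mathrm{C}_\alpha t, \mathrm{C}_\alpha t].$$
   Context: Let $\Gamma_0 = \{\eta\subset\mathbb{R} : |\eta|<\infty\}$ be the collection of finite subsets of $\mathbb{R}$. For $\alpha>\frac12$ let $c_\alpha>0$ be the constant such that $a(z) = \frac{c_\alpha}{(1+|z|^2)^\alpha}$, $z\in\mathbb{R}$, satisfies $\int_{\mathbb{R}} a(z)\,dz = 1$. The birth rate is $b(x,\eta) = 1\wedge\big(\sum_{y\in\eta} a(x-y)\big)$, $x\in\mathbb{R}$, $\eta\in\Gamma_0$. The birth process $(\eta_t)_{t\ge0}$ is the $\Gamma_0$-valued pure-birth process in which, when the current state is $\eta$, a new particle (point) appears in a bounded Borel set $B$ at rate $\int_B b(x,\eta)\,dx$. Precisely, it is the unique c\`adl\`ag $\Gamma_0$-valued solution of $$|\eta_t\cap B| = \int_{(0,t]\times B\times[0,\infty)} \mathbf{1}_{[0,b(x,\eta_{s-})]}(u)\,N(ds,dx,du) + |\eta_0\cap B|,$$ the equality holding a.s. for every $t\ge0$ and every bounded $B\in\mathscr{B}(\mathbb{R})$, where $N$ is a Poisson point process on $\mathbb{R}_+\times\mathbb{R}\times\mathbb{R}_+$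 with mean measure $ds\times dx\times du$. *)

theory Defs
  imports "HOL-Probability.Probability"
begin

text \<open>The measure-valued map \<open>N\<close> is a Poisson point process with mean measure \<open>\<mu>\<close>. Points are
  counted with multiplicity, so a realisation is an integer-valued measure. For \<open>\<sigma>\<close>-finite \<open>\<mu>\<close>,
  its values on sets of infinite mean measure and its almost sure \<open>\<sigma>\<close>-finiteness are determined by
  the conditions on sets of finite mean measure.\<close>

definition poisson_point_process ::
    "'w measure \<Rightarrow> 'a measure \<Rightarrow> ('w \<Rightarrow> 'a measure) \<Rightarrow> bool" where
  "poisson_point_process M \<mu> N \<longleftrightarrow>
     prob_space M \<and>
     (\<forall>\<omega>\<in>space M. sets (N \<omega>) = sets \<mu> \<and>
        (\<forall>A\<in>sets \<mu>. emeasure (N \<omega>) A \<in> range ennreal_of_enat)) \<and>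
     (\<forall>A\<in>sets \<mu>. (\<lambda>\<omega>. emeasure (N \<omega>) A) \<in> borel_measurable M) \<and>
     (\<forall>A\<in>sets \<mu>. emeasure \<mu> A < \<infinity> \<longrightarrow>
        (\<forall>k::nat. measure M {\<omega>\<in>space M. emeasure (N \<omega>) A = of_nat k}
                  = measure \<mu> A ^ k / fact k * exp (- measure \<mu> A))) \<and>
     (\<forall>(I::nat set) A. finite I \<longrightarrow> A ` I \<subseteq> sets \<mu> \<longrightarrow> disjoint_family_on A I \<longrightarrow>
        prob_space.indep_vars M (\<lambda>_. borel) (\<lambda>i \<omega>. emeasure (N \<omega>) (A i)) I)"

text \<open>The space \<open>\<Gamma>\<^sub>0\<close> of finite subsets of the line, with the topology of weak convergence of the
  associated counting measures. Constant test functions make the cardinality continuous, so this is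
  also the disjoint union of the spaces of \<open>n\<close>-point subsets, each with the topology that it has as
  a quotient of the \<open>n\<close>-tuples of distinct points.\<close>

definition finite_config_topology :: "real set topology" where
  "finite_config_topology = topology_generated_by
     {{\<eta>. finite \<eta> \<and> (\<Sum>y\<in>\<eta>. f y) \<in> U} | (f :: real \<Rightarrow> real) U.
        continuous_on UNIV f \<and> bounded (range f) \<and> open U}"

definition cadlag :: "'b topology \<Rightarrow> (real \<Rightarrow> 'b) \<Rightarrow> bool" where
  "cadlag X f \<longleftrightarrow> (\<forall>t\<ge>0. limitin X f (f t) (at_right t)) \<and>
                 (\<forall>t>0. \<exists>l. limitin X f l (at_left t))"

definition left_limit :: "'b topology \<Rightarrow> (real \<Rightarrow> 'b) \<Rightarrow> real \<Rightarrow> 'b" where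
  "left_limit X f t = (THE l. limitin X f l (at_left t))"

definition dispersal_kernel :: "real \<Rightarrow> real \<Rightarrow> real \<Rightarrow> real" where
  "dispersal_kernel c \<alpha> z = c / (1 + \<bar>z\<bar>\<^sup>2) powr \<alpha>"

definition birth_rate :: "(real \<Rightarrow> real) \<Rightarrow> real \<Rightarrow> real set \<Rightarrow> real" where
  "birth_rate a x \<eta> = min 1 (\<Sum>y\<in>\<eta>. a (x - y))"

definition birth_process ::
    "'w measure \<Rightarrow> (real \<Rightarrow> real set \<Rightarrow> real) \<Rightarrow> ('w \<Rightarrow> (real \<times> real \<times> real) measure) \<Rightarrow>
     (real \<Rightarrow> 'w \<Rightarrow> real set) \<Rightarrow> bool" where
  "birth_process M b N \<eta> \<longleftrightarrow>
     poisson_point_process M (restrict_space lborel ({0..} \<times> UNIV \<times> {0..})) N \<and>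
     (\<forall>t\<ge>0. \<forall>\<omega>\<in>space M. finite (\<eta> t \<omega>)) \<and>
     (\<forall>t\<ge>0. \<forall>B\<in>sets borel. (\<lambda>\<omega>. card (\<eta> t \<omega> \<inter> B)) \<in> measurable M (count_space UNIV)) \<and>
     (AE \<omega> in M. cadlag finite_config_topology (\<lambda>t. \<eta> t \<omega>)) \<and>
     (\<forall>t\<ge>0. \<forall>B\<in>sets borel. bounded B \<longrightarrow>
        (AE \<omega> in M. of_nat (card (\<eta> t \<omega> \<inter> B)) =
           (\<integral>\<^sup>+ (s, x, u). indicator ({0<..t} \<times> B \<times> {0..}) (s, x, u) *
              indicator {0..b x (left_limit finite_config_topology (\<lambda>r. \<eta> r \<omega>) s)} u \<partial>(N \<omega>))
           + of_nat (card (\<eta> 0 \<omega> \<inter> B))))"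

end

theory Submission
  imports Defs
begin

text \<open>Cut the line into the shells \<open>i \<le> |x| < i + 1\<close> and let the front be the index of the outermost
  occupied shell. When the front jumps by \<open>r\<close>, landing at a Poisson point with mark \<open>u\<close>, either
  \<open>u \<le> r\<^sup>-\<^sup>\<alpha>\<close> (a good jump), or the field \<open>\<Sum>\<^sub>y a (x - y)\<close> of the particles present exceeds \<open>r\<^sup>-\<^sup>\<alpha>\<close>
  (a bad jump).

  Since \<open>a\<close> decays like \<open>d\<^sup>-\<^sup>2\<^sup>\<alpha>\<close>, a bad jump satisfies \<open>r \<le> c\<^sub>1 \<Sum>\<^sub>y r d\<^sub>y\<^sup>-\<^sup>\<alpha>\<close>, where \<open>d\<^sub>y \<ge> r\<close> is the
  distance from the source \<open>y\<close> to the landing shell. A particle born at distance \<open>e\<close> behind the front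
  contributes to all later bad jumps together at most \<open>\<Sum>\<^sub>d\<^sub>>\<^sub>e d\<^sup>-\<^sup>\<alpha>\<close>, and these weights are summable over \<open>e\<close>
  because \<open>\<alpha> > 2\<close>. So the bad jumps advance the front by at most a weighted sum of Poisson counts along
  the space-time path of the front; exponential moments beat the number of discretised monotone paths.

  The landing points of the good jumps of length about \<open>2\<^sup>m\<close> form an increasing space-time chain of
  Poisson points of intensity \<open>2\<^sup>-\<^sup>\<alpha>\<^sup>m\<close>. In a box of size \<open>T \<times> C T\<close> the longest such chain has length of
  order \<open>\<surd>C T 2\<^sup>-\<^sup>\<alpha>\<^sup>m\<^sup>/\<^sup>2\<close>, and \<open>\<Sum>\<^sub>m 2\<^sup>m 2\<^sup>-\<^sup>\<alpha>\<^sup>m\<^sup>/\<^sup>2\<close> converges, again because \<open>\<alpha> > 2\<close>. Very long good jumps do not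
  occur, with probability \<open>1 - O(T\<^sup>-\<^sup>\<epsilon>)\<close>. The Borel-Cantelli lemma along \<open>T = 2\<^sup>p\<close> and monotonicity of
  the process conclude.\<close>

section \<open>Finite configurations and shells\<close>

lemma topspace_finite_config: "topspace finite_config_topology = {\<eta>. finite \<eta>}"
proof -
  have "{\<eta>. finite \<eta>} = {\<eta>. finite \<eta> \<and> (\<Sum>y\<in>\<eta>. (\<lambda>_. 0::real) y) \<in> UNIV}" by simp
  also have "\<dots> \<in> {{\<eta>. finite \<eta> \<and> (\<Sum>y\<in>\<eta>. f y) \<in> U} | (f :: real \<Rightarrow> real) U.
        continuous_on UNIV f \<and> bounded (range f) \<and> open U}"
    by (rule CollectI, rule exI[of _ "\<lambda>_. 0::real"], rule exI[of _ UNIV]) simp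
  finally have "{\<eta>. finite \<eta>} \<subseteq> \<Union>{{\<eta>. finite \<eta> \<and> (\<Sum>y\<in>\<eta>. f y) \<in> U} | (f :: real \<Rightarrow> real) U.
        continuous_on UNIV f \<and> bounded (range f) \<and> open U}" by blast
  then show ?thesis
    unfolding finite_config_topology_def topology_generated_by_topspace by auto
qed

text \<open>Preimages of open sets under sums of an admissible test function are sub-basic, so such
  sums pass to the limit.\<close>

lemma limitin_config_sum:
  assumes "limitin finite_config_topology f l F"
    and "continuous_on UNIV g" "bounded (range (g :: real \<Rightarrow> real))"
  shows "((\<lambda>t. \<Sum>y\<in>f t. g y) \<longlongrightarrow> (\<Sum>y\<in>l. g y)) F"
proof (rule topological_tendstoI)
  fix U :: "real set" assume U: "open U" "(\<Sum>y\<in>l. g y) \<in> U"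
  let ?V = "{\<eta>. finite \<eta> \<and> (\<Sum>y\<in>\<eta>. g y) \<in> U}"
  have "finite l" using assms(1) by (auto simp: limitin_def topspace_finite_config)
  moreover have "openin finite_config_topology ?V"
    unfolding finite_config_topology_def
    by (rule topology_generated_by_Basis) (use assms U in blast)
  ultimately have "\<forall>\<^sub>F t in F. f t \<in> ?V"
    using assms(1) U unfolding limitin_def by blast
  then show "\<forall>\<^sub>F t in F. (\<Sum>y\<in>f t. g y) \<in> U" by eventually_elim simp
qed

text \<open>A tent of height 1 at \<open>y\<close>, supported in the closed ball of radius
  \<open>e\<close>: continuous and bounded, hence an admissible test function, and positive at
  \<open>z\<close> only if \<open>z\<close> is near \<open>y\<close>.\<close>

definition bump :: "real \<Rightarrow> real \<Rightarrow> real \<Rightarrow> real" where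
  "bump y e z = max 0 (1 - \<bar>z - y\<bar> / e)"

lemma bump_facts:
  assumes "e > 0"
  shows "continuous_on UNIV (bump y e)" "bounded (range (bump y e))" "bump y e y = 1"
    "bump y e z \<ge> 0" "e \<le> \<bar>z - y\<bar> \<Longrightarrow> bump y e z = 0"
proof -
  show "continuous_on UNIV (bump y e)"
    unfolding bump_def by (intro continuous_intros) (use assms in auto)
  show "bounded (range (bump y e))"
    unfolding bounded_iff bump_def using assms by (intro exI[of _ 1]) auto
  show "bump y e y = 1" "bump y e z \<ge> 0" by (auto simp: bump_def)
  show "e \<le> \<bar>z - y\<bar> \<Longrightarrow> bump y e z = 0" using assms by (simp add: bump_def field_simps)
qed

text \<open>Finite sets are closed. This recovers exact positions from small neighbourhoods, which
  are all that test functions and counts in balls can see.\<close>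

lemma finite_set_mem_if_near:
  fixes y :: real
  assumes "finite l" "\<And>e. e > 0 \<Longrightarrow> l \<inter> ball y e \<noteq> {}"
  shows "y \<in> l"
proof -
  have "closed l" using assms(1) by (rule finite_imp_closed)
  moreover have "y \<in> closure l"
    unfolding closure_approachable using assms(2) by (force simp: dist_commute)
  ultimately show ?thesis by simp
qed

lemma sum_bump_near:
  assumes "e > 0" "(\<Sum>z\<in>l. bump y e z) > 0"
  shows "l \<inter> ball y e \<noteq> {}"
proof
  assume "l \<inter> ball y e = {}"
  then have "bump y e z = 0" if "z \<in> l" for z
    using that bump_facts(5)[OF assms(1), of z y] by (force simp: dist_real_def abs_minus_commute not_less)
  then show False using assms(2) by simp
qed

lemma sum_bump_ge:
  assumes "e > 0" "finite l" "y \<in> l"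
  shows "(\<Sum>z\<in>l. bump y e z) \<ge> 1"
proof -
  have "bump y e y \<le> (\<Sum>z\<in>l. bump y e z)"
    by (rule member_le_sum) (use assms bump_facts(4)[OF assms(1)] in auto)
  then show ?thesis using bump_facts(3)[OF assms(1)] by simp
qed

text \<open>Tents separate configurations: a point of one limit has points of the other arbitrarily
  near. Uniqueness gives meaning to the definite description in \<open>left_limit\<close>.\<close>

lemma limitin_config_unique:
  assumes "limitin finite_config_topology f l F" "limitin finite_config_topology f l' F" "F \<noteq> bot"
  shows "l = l'"
proof -
  have sub: "l1 \<subseteq> l2" if l1: "limitin finite_config_topology f l1 F"
      and l2: "limitin finite_config_topology f l2 F" for l1 l2
  proof
    fix y assume y: "y \<in> l1"
    have fin: "finite l1" "finite l2"
      using l1 l2 by (auto simp: limitin_def topspace_finite_config)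
    show "y \<in> l2"
    proof (rule finite_set_mem_if_near[OF fin(2)])
      fix e :: real assume e: "e > 0"
      have "(\<Sum>z\<in>l1. bump y e z) = (\<Sum>z\<in>l2. bump y e z)"
        by (rule tendsto_unique[OF assms(3)])
          (use l1 l2 bump_facts[OF e] in \<open>auto intro!: limitin_config_sum\<close>)
      then show "l2 \<inter> ball y e \<noteq> {}"
        using sum_bump_ge[OF e fin(1) y] by (intro sum_bump_near[OF e]) simp
    qed
  qed
  show ?thesis using sub assms by blast
qed

text \<open>Radial blocks treat both ends of the line at once: \<open>\<bar>x - y\<bar> \<ge> \<bar>\<bar>x\<bar> - \<bar>y\<bar>\<bar>\<close>.\<close>

definition blk :: "real \<Rightarrow> nat" where
  "blk x = nat \<lfloor>\<bar>x\<bar>\<rfloor>"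

definition shell :: "nat \<Rightarrow> real set" where
  "shell i = {x. blk x = i}"

lemma blk_bounds: "real (blk x) \<le> \<bar>x\<bar>" "\<bar>x\<bar> < real (blk x) + 1"
  unfolding blk_def by (simp_all add: of_nat_nat)

lemma mem_shell: "x \<in> shell i \<longleftrightarrow> real i \<le> \<bar>x\<bar> \<and> \<bar>x\<bar> < real i + 1"
proof -
  have "blk x = i \<longleftrightarrow> \<lfloor>\<bar>x\<bar>\<rfloor> = int i"
    unfolding blk_def by (metis abs_ge_zero int_nat_eq nat_int zero_le_floor)
  then show ?thesis by (simp add: shell_def floor_eq_iff)
qed

lemma shell_eq: "shell i = {- real i - 1<..- real i} \<union> {real i..<real i + 1}"
  by (auto simp: mem_shell)

lemma shell_borel [measurable, simp]: "shell i \<in> sets borel"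
  by (simp add: shell_eq)

lemma bounded_shell: "bounded (shell i)"
  unfolding bounded_iff by (rule exI[of _ "real i + 1"]) (auto simp: mem_shell)

lemma emeasure_shell: "emeasure lborel (shell i) = 2"
proof (cases "i = 0")
  case True
  \<comment> \<open>The two half-open intervals of \<open>shell_eq\<close> overlap at the origin
    here, so they are merged into one.\<close>
  have "shell i = {-1<..<1}" using True by (auto simp: mem_shell)
  then show ?thesis by simp
next
  case False
  have "emeasure lborel (shell i) = emeasure lborel {- real i - 1<..- real i} + emeasure lborel {real i..<real i + 1}"
    unfolding shell_eq by (rule plus_emeasure[symmetric]) (use False in auto)
  then show ?thesis by (simp flip: ennreal_plus)
qed

lemma disjoint_shell: "i \<noteq> j \<Longrightarrow> shell i \<inter> shell j = {}"
  by (auto simp: shell_def)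

section \<open>Boxes in time, space and mark, and their mean measure\<close>

abbreviation dom3 :: "(real \<times> real \<times> real) set" where
  "dom3 \<equiv> {0..} \<times> UNIV \<times> {0..}"

definition ambient :: "(real \<times> real \<times> real) measure" where
  "ambient = restrict_space lborel dom3"

lemma sets_lborel3: "sets (lborel :: (real \<times> real \<times> real) measure) = sets (borel \<Otimes>\<^sub>M (borel \<Otimes>\<^sub>M borel))"
proof -
  have "borel \<Otimes>\<^sub>M (borel \<Otimes>\<^sub>M borel) = (borel :: (real \<times> real \<times> real) measure)"
    by (simp only: borel_prod)
  then show ?thesis by (metis sets_lborel)
qed

lemma dom3_sets: "dom3 \<inter> space lborel \<in> sets lborel"
  unfolding sets_lborel3 by auto

lemma box_sets_ambient:
  assumes "A \<in> sets borel" "B \<in> sets borel" "U \<in> sets borel" "A \<subseteq> {0..}" "U \<subseteq> {0..}"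
  shows "A \<times> B \<times> U \<in> sets ambient"
proof -
  have "A \<times> B \<times> U \<in> sets lborel" unfolding sets_lborel3 using assms by auto
  then show ?thesis unfolding ambient_def
    by (subst sets_restrict_space_iff[OF dom3_sets]) (use assms in auto)
qed

lemma emeasure_ambient_box:
  assumes "A \<in> sets borel" "B \<in> sets borel" "U \<in> sets borel" "A \<subseteq> {0..}" "U \<subseteq> {0..}"
  shows "emeasure ambient (A \<times> B \<times> U)
      = emeasure lborel A * (emeasure lborel B * emeasure lborel U)"
proof -
  have "emeasure ambient (A \<times> B \<times> U) = emeasure lborel (A \<times> B \<times> U)"
    unfolding ambient_def by (rule emeasure_restrict_space[OF dom3_sets]) (use assms in auto)
  also have "\<dots> = emeasure (lborel \<Otimes>\<^sub>M (lborel \<Otimes>\<^sub>M lborel)) (A \<times> B \<times> U)"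
    by (simp add: lborel_prod)
  also have "\<dots> = emeasure lborel A * emeasure (lborel \<Otimes>\<^sub>M lborel) (B \<times> U)"
    by (rule sigma_finite_measure.emeasure_pair_measure_Times)
      (use assms in \<open>auto simp: lborel_prod lborel.sigma_finite_measure_axioms\<close>)
  also have "emeasure (lborel \<Otimes>\<^sub>M lborel) (B \<times> U) = emeasure lborel B * emeasure lborel U"
    by (rule lborel.emeasure_pair_measure_Times) (use assms in auto)
  finally show ?thesis .
qed

section \<open>Trajectories of the birth process\<close>

abbreviation lim_before :: "(real \<Rightarrow> real set) \<Rightarrow> real \<Rightarrow> real set" where
  "lim_before \<equiv> left_limit finite_config_topology"

text \<open>The equation of the process for one realisation, one time and one set, so that null sets
  can be collected over countably many instances.\<close>

definition balance ::
    "(real \<times> real \<times> real) measure \<Rightarrow> (real \<Rightarrow> real) \<Rightarrow> (real \<Rightarrow> real set) \<Rightarrow> real \<Rightarrow> real set \<Rightarrow> bool" where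
  "balance \<nu> a h t B \<longleftrightarrow> of_nat (card (h t \<inter> B)) =
     (\<integral>\<^sup>+ (s, x, u). indicator ({0<..t} \<times> B \<times> {0..}) (s, x, u) *
        indicator {0..birth_rate a x (lim_before h s)} u \<partial>\<nu>) + of_nat (card (h 0 \<inter> B))"

text \<open>Half-open in time, as in the equation of the process, so that consecutive slabs are
  disjoint; \<open>w\<close> stands for an upper bound on the birth rate.\<close>

definition slab :: "real \<Rightarrow> real \<Rightarrow> nat \<Rightarrow> real \<Rightarrow> (real \<times> real \<times> real) set" where
  "slab s t i w = {s<..t} \<times> shell i \<times> {0..w}"

lemma slab_sets [intro]: "0 \<le> s \<Longrightarrow> slab s t i w \<in> sets ambient"
  unfolding slab_def by (rule box_sets_ambient) auto

text \<open>Deterministic properties of almost every realisation. The equation is assumed at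
  rational times and for countably many sets only, because it holds almost surely for each time and
  set separately.\<close>

locale growth_path =
  fixes \<nu> :: "(real \<times> real \<times> real) measure" and h :: "real \<Rightarrow> real set" and a :: "real \<Rightarrow> real"
  assumes sets_nu: "sets \<nu> = sets ambient"
    and enat_nu: "A \<in> sets ambient \<Longrightarrow> emeasure \<nu> A \<in> range ennreal_of_enat"
    and fin: "0 \<le> t \<Longrightarrow> finite (h t)"
    and cadlag: "cadlag finite_config_topology h"
    and a_meas [measurable]: "a \<in> borel_measurable borel"
    and balance_ball: "\<lbrakk>q \<in> \<rat>; 0 \<le> q; y \<in> \<rat>; e \<in> \<rat>\<rbrakk> \<Longrightarrow> balance \<nu> a h q (ball y e)"
    and balance_shell: "\<lbrakk>q \<in> \<rat>; 0 \<le> q\<rbrakk> \<Longrightarrow> balance \<nu> a h q (shell i)"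
    and fin_nu: "emeasure \<nu> (slab 0 (real n) i 1) < \<infinity>"
    and start: "h 0 = {0}"
begin

text \<open>The integral in \<open>balance\<close> is nondecreasing in time, hence so are the counts
  in rational balls; shrinking the balls turns this into inclusion.\<close>

lemma mono_rat:
  assumes "q \<in> \<rat>" "q' \<in> \<rat>" "0 \<le> q" "q \<le> q'"
  shows "h q \<subseteq> h q'"
proof
  fix y assume y: "y \<in> h q"
  have fin': "finite (h q)" "finite (h q')" using assms by (auto intro: fin)
  show "y \<in> h q'"
  proof (rule finite_set_mem_if_near[OF fin'(2)])
    fix e :: real assume e: "e > 0"
    \<comment> \<open>A rational ball that contains \<open>y\<close> and lies inside
      \<open>ball y e\<close>.\<close>
    obtain y' where y': "y' \<in> \<rat>" "y - e/4 < y'" "y' < y + e/4"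
      using Rats_dense_in_real[of "y - e/4" "y + e/4"] e by auto
    obtain e' where e': "e' \<in> \<rat>" "e/4 < e'" "e' < e/2"
      using Rats_dense_in_real[of "e/4" "e/2"] e by auto
    have b: "balance \<nu> a h q (ball y' e')" "balance \<nu> a h q' (ball y' e')"
      using balance_ball assms y' e' by auto
    have "of_nat (card (h q \<inter> ball y' e')) \<le> (of_nat (card (h q' \<inter> ball y' e')) :: ennreal)"
      unfolding b[unfolded balance_def]
      by (intro add_right_mono nn_integral_mono) (use assms in \<open>auto split: split_indicator\<close>)
    then have "card (h q \<inter> ball y' e') \<le> card (h q' \<inter> ball y' e')" by simp
    moreover have "y \<in> ball y' e'" using y' e' by (auto simp: dist_real_def)
    then have "card (h q \<inter> ball y' e') > 0" using y fin' by (auto simp: card_gt_0_iff)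
    ultimately have "h q' \<inter> ball y' e' \<noteq> {}" by auto
    moreover have "ball y' e' \<subseteq> ball y e" using y' e' by (auto simp: dist_real_def)
    ultimately show "h q' \<inter> ball y e \<noteq> {}" by blast
  qed
qed

lemma right_limit: "0 \<le> t \<Longrightarrow> limitin finite_config_topology h (h t) (at_right t)"
  using cadlag unfolding cadlag_def by blast

text \<open>By right continuity, rational times just after \<open>s\<close> still show a point near
  \<open>y\<close>; from there \<open>mono_rat\<close> leads to \<open>q\<close>.\<close>

lemma subset_rat:
  assumes "0 \<le> s" "s < q" "q \<in> \<rat>"
  shows "h s \<subseteq> h q"
proof
  fix y assume y: "y \<in> h s"
  have fin': "finite (h s)" "finite (h q)" using assms by (auto intro: fin)
  show "y \<in> h q"
  proof (rule finite_set_mem_if_near[OF fin'(2)])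
    fix e :: real assume e: "e > 0"
    have "((\<lambda>t. \<Sum>z\<in>h t. bump y e z) \<longlongrightarrow> (\<Sum>z\<in>h s. bump y e z)) (at_right s)"
      using bump_facts[OF e] assms by (intro limitin_config_sum right_limit) auto
    moreover have "(\<Sum>z\<in>h s. bump y e z) > 0" using sum_bump_ge[OF e fin'(1) y] by simp
    ultimately have "\<forall>\<^sub>F t in at_right s. (\<Sum>z\<in>h t. bump y e z) > 0"
      by (rule order_tendstoD(1))
    then obtain d where d: "d > s" "\<And>t. s < t \<Longrightarrow> t < d \<Longrightarrow> (\<Sum>z\<in>h t. bump y e z) > 0"
      unfolding eventually_at_right_field by blast
    obtain r where r: "r \<in> \<rat>" "s < r" "r < min d q"
      using Rats_dense_in_real[of s "min d q"] d assms by auto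
    have "h r \<inter> ball y e \<noteq> {}" using r d by (intro sum_bump_near[OF e]) auto
    moreover have "h r \<subseteq> h q" using r assms by (intro mono_rat) auto
    ultimately show "h q \<inter> ball y e \<noteq> {}" by blast
  qed
qed

text \<open>The constant test function 1 makes the cardinality right-continuous, and an
  integer-valued right-continuous function is locally constant to the right.\<close>

lemma right_card:
  assumes "0 \<le> t"
  shows "\<exists>d>t. \<forall>r. t \<le> r \<and> r < d \<longrightarrow> card (h r) = card (h t)"
proof -
  have "((\<lambda>r. \<Sum>z\<in>h r. 1) \<longlongrightarrow> (\<Sum>z\<in>h t. 1 :: real)) (at_right t)"
    using assms by (intro limitin_config_sum right_limit) auto
  then have "\<forall>\<^sub>F r in at_right t. dist (real (card (h r))) (real (card (h t))) < 1"
    by (intro tendstoD) auto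
  then obtain d where d: "d > t" "\<And>r. t < r \<Longrightarrow> r < d \<Longrightarrow> dist (real (card (h r))) (real (card (h t))) < 1"
    unfolding eventually_at_right_field by blast
  have "card (h r) = card (h t)" if "t \<le> r" "r < d" for r
  proof (cases "r = t")
    case False
    then have "dist (real (card (h r))) (real (card (h t))) < 1" using d that by auto
    then show ?thesis by (simp add: dist_real_def)
  qed simp
  then show ?thesis using d by blast
qed

text \<open>A rational time \<open>q\<close> just after \<open>t\<close> has a configuration
  containing \<open>h t\<close> with the same cardinality, hence equal to it; so \<open>t\<close>
  may be replaced by \<open>q\<close>.\<close>

lemma mono:
  assumes "0 \<le> s" "s \<le> t"
  shows "h s \<subseteq> h t"
proof (cases "s = t")
  case False
  obtain d where d: "d > t" "\<And>r. t \<le> r \<Longrightarrow> r < d \<Longrightarrow> card (h r) = card (h t)"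
    using right_card[of t] assms by auto
  obtain q where q: "q \<in> \<rat>" "t < q" "q < d" using Rats_dense_in_real d(1) by blast
  have "h t \<subseteq> h q" using assms q by (intro subset_rat) auto
  then have "h t = h q" using d(2)[of q] q assms by (intro card_subset_eq fin) auto
  moreover have "h s \<subseteq> h q" using assms q by (intro subset_rat) auto
  ultimately show ?thesis by simp
qed simp

lemma right_const:
  assumes "0 \<le> t"
  shows "\<exists>d>t. \<forall>r. t \<le> r \<and> r < d \<longrightarrow> h r = h t"
proof -
  obtain d where d: "d > t" "\<And>r. t \<le> r \<Longrightarrow> r < d \<Longrightarrow> card (h r) = card (h t)"
    using right_card[OF assms] by auto
  have "h r = h t" if "t \<le> r" "r < d" for r
    using card_subset_eq[OF fin mono[OF assms that(1)]] d(2)[OF that] that assms by auto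
  then show ?thesis using d by blast
qed

text \<open>Before \<open>t\<close> the cardinality is bounded by that of \<open>h t\<close>, so it
  attains a maximum; from then until \<open>t\<close> an increasing family of finite sets cannot
  change. The left limit is this final value.\<close>

lemma lim_before:
  assumes "0 < t"
  shows "\<exists>s\<ge>0. s < t \<and> (\<forall>r. s \<le> r \<and> r < t \<longrightarrow> h r = lim_before h t)"
proof -
  have "card (h r) \<le> card (h t)" if "0 \<le> r" "r < t" for r
    using that mono[of r t] fin[of t] by (intro card_mono) auto
  then have "finite ((\<lambda>r. card (h r)) ` {0..<t})"
    by (metis (no_types, lifting) atMost_iff atLeastLessThan_iff finite_atMost finite_subset image_subsetI)
  moreover have "(\<lambda>r. card (h r)) ` {0..<t} \<noteq> {}" using assms by auto
  ultimately have "Max ((\<lambda>r. card (h r)) ` {0..<t}) \<in> (\<lambda>r. card (h r)) ` {0..<t}"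
    by (rule Max_in)
  then obtain s where s: "0 \<le> s" "s < t" "card (h s) = Max ((\<lambda>r. card (h r)) ` {0..<t})"
    by auto
  have const: "h r = h s" if "s \<le> r" "r < t" for r
  proof -
    have "card (h r) \<le> card (h s)" unfolding s(3)
      by (rule Max_ge) (use that s \<open>finite ((\<lambda>r. card (h r)) ` {0..<t})\<close> in auto)
    then show ?thesis using card_seteq[OF fin[of r] mono[of s r]] that s by auto
  qed
  have "limitin finite_config_topology h (h s) (at_left t)"
  proof (rule limitin_eventually)
    show "h s \<in> topspace finite_config_topology" using s fin by (simp add: topspace_finite_config)
    show "\<forall>\<^sub>F r in at_left t. h r = h s"
      unfolding eventually_at_left_field using s(2) const[OF less_imp_le] by blast
  qed
  moreover from this have "l = h s" if "limitin finite_config_topology h l (at_left t)" for l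
    by (rule limitin_config_unique[OF that]) (use \<open>limitin finite_config_topology h (h s) (at_left t)\<close> in simp_all)
  ultimately have "lim_before h t = h s" unfolding left_limit_def by (rule the_equality)
  then have "h r = lim_before h t" if "s \<le> r" "r < t" for r using const[OF that] by metis
  then show ?thesis using s by blast
qed

lemma lim_before_mem:
  assumes "0 < t"
  shows "y \<in> lim_before h t \<longleftrightarrow> (\<exists>q\<in>\<rat>. 0 \<le> q \<and> q < t \<and> y \<in> h q)"
proof -
  obtain s where s: "0 \<le> s" "s < t" "\<And>r. s \<le> r \<Longrightarrow> r < t \<Longrightarrow> h r = lim_before h t"
    using lim_before[OF assms] by auto
  show ?thesis
  proof
    assume y: "y \<in> lim_before h t"
    obtain q where "q \<in> \<rat>" "s < q" "q < t" using Rats_dense_in_real s(2) by blast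
    then show "\<exists>q\<in>\<rat>. 0 \<le> q \<and> q < t \<and> y \<in> h q" using y s by (intro bexI[of _ q]) auto
  next
    assume "\<exists>q\<in>\<rat>. 0 \<le> q \<and> q < t \<and> y \<in> h q"
    then obtain q where "0 \<le> q" "q < t" "y \<in> h q" by blast
    then have "y \<in> h (max q s)" using mono[of q "max q s"] by auto
    then show "y \<in> lim_before h t" using s(3)[of "max q s"] \<open>q < t\<close> s(2) by auto
  qed
qed

lemma lim_before_subset:
  assumes "0 < t"
  shows "lim_before h t \<subseteq> h t"
proof
  fix y assume "y \<in> lim_before h t"
  then obtain q where "0 \<le> q" "q < t" "y \<in> h q" using lim_before_mem[OF assms] by blast
  then show "y \<in> h t" using mono[of q t] by auto
qed

section \<open>Births as points of the random measure\<close>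

definition born :: "real \<Rightarrow> real set \<Rightarrow> (real \<times> real \<times> real) set" where
  "born t B = {(s, x, u). 0 < s \<and> s \<le> t \<and> x \<in> B \<and> 0 \<le> u \<and> u \<le> birth_rate a x (lim_before h s)}"

text \<open>Up to time \<open>t\<close> only the finitely many particles of \<open>h t\<close>
  matter, and each belongs to the left limit exactly on the open set \<open>up y\<close> of times.
  So the rate is a finite sum of measurable functions of time and position.\<close>

lemma born_sets:
  assumes [measurable]: "B \<in> sets borel" and t: "0 \<le> t"
  shows "born t B \<in> sets ambient"
proof -
  define up where "up y = (\<Union>q\<in>{q \<in> \<rat>. 0 \<le> q \<and> y \<in> h q}. {q<..})" for y
  have [measurable]: "up y \<in> sets borel" for y
    unfolding up_def by (intro borel_open open_UN) auto
  have eq: "(\<Sum>y\<in>lim_before h s. a (x - y)) = (\<Sum>y\<in>h t. indicator (up y) s * a (x - y))"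
    if "0 < s" "s \<le> t" for s x
  proof -
    have "lim_before h s = {y \<in> h t. s \<in> up y}"
      using lim_before_subset[of s] mono[of s t] that by (auto simp: up_def lim_before_mem)
    then have "(\<Sum>y\<in>lim_before h s. a (x - y)) = (\<Sum>y\<in>{y \<in> h t. s \<in> up y}. a (x - y))" by simp
    also have "\<dots> = (\<Sum>y\<in>h t. if s \<in> up y then a (x - y) else 0)"
      using fin[OF t] by (simp add: sum.inter_filter)
    also have "\<dots> = (\<Sum>y\<in>h t. indicator (up y) s * a (x - y))"
      by (intro sum.cong) (auto split: split_indicator)
    finally show ?thesis .
  qed
  have "born t B = {(s, x, u). 0 < s \<and> s \<le> t \<and> x \<in> B \<and> 0 \<le> u \<and>
      u \<le> min 1 (\<Sum>y\<in>h t. indicator (up y) s * a (x - y))}"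
    unfolding born_def birth_rate_def by (auto simp: eq)
  also have "\<dots> = {p \<in> space (borel \<Otimes>\<^sub>M (borel \<Otimes>\<^sub>M borel)). 0 < fst p \<and> fst p \<le> t \<and> fst (snd p) \<in> B \<and>
      0 \<le> snd (snd p) \<and> snd (snd p) \<le> min 1 (\<Sum>y\<in>h t. indicator (up y) (fst p) * a (fst (snd p) - y))}"
    by (auto simp: space_pair_measure)
  also have "\<dots> \<in> sets (borel \<Otimes>\<^sub>M (borel \<Otimes>\<^sub>M borel))"
    by measurable
  finally have "born t B \<in> sets lborel" unfolding sets_lborel3 .
  then show ?thesis unfolding ambient_def
    by (subst sets_restrict_space_iff[OF dom3_sets]) (auto simp: born_def)
qed

lemma balance_born:
  assumes "balance \<nu> a h t B" "B \<in> sets borel" "0 \<le> t"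
  shows "of_nat (card (h t \<inter> B)) = emeasure \<nu> (born t B) + of_nat (card (h 0 \<inter> B))"
proof -
  have "(\<integral>\<^sup>+ (s, x, u). indicator ({0<..t} \<times> B \<times> {0..}) (s, x, u) *
        indicator {0..birth_rate a x (lim_before h s)} u \<partial>\<nu>) = (\<integral>\<^sup>+ p. indicator (born t B) p \<partial>\<nu>)"
    by (intro nn_integral_cong) (auto simp: born_def indicator_def)
  also have "\<dots> = emeasure \<nu> (born t B)"
    using born_sets[OF assms(2,3)] sets_nu by (intro nn_integral_indicator) auto
  finally show ?thesis using assms(1) unfolding balance_def by simp
qed

text \<open>Particles never disappear, so the balance equations at the two times can be subtracted;
  the counts are finite and therefore cancel.\<close>

lemma births_between:
  assumes "q \<in> \<rat>" "q' \<in> \<rat>" "0 \<le> q" "q \<le> q'"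
  shows "of_nat (card ((h q' - h q) \<inter> shell i)) = emeasure \<nu> (born q' (shell i) - born q (shell i))"
proof -
  have sub: "born q (shell i) \<subseteq> born q' (shell i)" using assms by (auto simp: born_def)
  have m: "born q (shell i) \<in> sets \<nu>" "born q' (shell i) \<in> sets \<nu>"
    using assms born_sets sets_nu by auto
  have e1: "of_nat (card (h q \<inter> shell i)) = emeasure \<nu> (born q (shell i)) + of_nat (card (h 0 \<inter> shell i))"
    and e2: "of_nat (card (h q' \<inter> shell i)) = emeasure \<nu> (born q' (shell i)) + of_nat (card (h 0 \<inter> shell i))"
    using assms by (auto intro!: balance_born balance_shell)
  have "h q' \<inter> shell i = (h q \<inter> shell i) \<union> ((h q' - h q) \<inter> shell i)"
    using mono[of q q'] assms by auto
  moreover have "card \<dots> = card (h q \<inter> shell i) + card ((h q' - h q) \<inter> shell i)"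
    by (rule card_Un_disjoint) (use fin[of q'] fin[of q] assms in auto)
  ultimately have "card (h q' \<inter> shell i) = card (h q \<inter> shell i) + card ((h q' - h q) \<inter> shell i)"
    by simp
  then have "of_nat (card (h q \<inter> shell i)) + of_nat (card ((h q' - h q) \<inter> shell i))
      = (of_nat (card (h q' \<inter> shell i)) :: ennreal)" by simp
  also have "\<dots> = emeasure \<nu> (born q (shell i)) + emeasure \<nu> (born q' (shell i) - born q (shell i))
      + of_nat (card (h 0 \<inter> shell i))"
    unfolding e2 using plus_emeasure[OF m(1) sets.Diff[OF m(2,1)]] sub by (simp add: Un_absorb1)
  also have "\<dots> = of_nat (card (h q \<inter> shell i)) + emeasure \<nu> (born q' (shell i) - born q (shell i))"
    unfolding e1 by (simp add: ac_simps)
  finally show ?thesis by (simp add: ennreal_add_left_cancel)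
qed

text \<open>The birth rate is capped at 1, so only points with mark at most 1 can cause
  births.\<close>

lemma births_between_le:
  assumes "q \<in> \<rat>" "q' \<in> \<rat>" "0 \<le> q" "q \<le> q'"
  shows "of_nat (card ((h q' - h q) \<inter> shell i)) \<le> emeasure \<nu> (slab q q' i 1)"
  unfolding births_between[OF assms]
proof (rule emeasure_mono)
  show "born q' (shell i) - born q (shell i) \<subseteq> slab q q' i 1"
    by (auto simp: born_def slab_def birth_rate_def)
  show "slab q q' i 1 \<in> sets \<nu>" using assms by (auto simp: sets_nu)
qed

lemma enat_lt_1: "A \<in> sets ambient \<Longrightarrow> emeasure \<nu> A < 1 \<Longrightarrow> emeasure \<nu> A = 0"
proof -
  assume A: "A \<in> sets ambient" "emeasure \<nu> A < 1"
  obtain n where n: "emeasure \<nu> A = ennreal_of_enat n" using enat_nu[OF A(1)] by auto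
  show ?thesis using A(2) unfolding n by (cases n) (auto simp: ennreal_of_nat_eq_real_of_nat)
qed

text \<open>Slabs over shrinking intervals after \<open>t\<close> decrease to the empty set, so
  their finite masses tend to 0; being integers, they eventually vanish.\<close>

lemma no_mass_right:
  assumes "0 \<le> t"
  shows "\<exists>d>t. emeasure \<nu> (slab t d i 1) = 0"
proof -
  define S where "S n = slab t (t + 1 / (real n + 1)) i 1" for n :: nat
  have m: "S n \<in> sets ambient" for n using assms by (auto simp: S_def)
  have "(\<lambda>n. emeasure \<nu> (S n)) \<longlonglongrightarrow> emeasure \<nu> (\<Inter>n. S n)"
  proof (rule Lim_emeasure_decseq)
    show "range S \<subseteq> sets \<nu>" using m sets_nu by auto
    show "decseq S"
    proof (rule decseq_SucI)
      fix n
      have "1 / (real (Suc n) + 1) \<le> 1 / (real n + 1)" by (simp add: frac_le)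
      then show "S (Suc n) \<subseteq> S n" by (auto simp: S_def slab_def)
    qed
    fix n
    obtain k where k: "t + 1 \<le> real k" using real_arch_simple by blast
    have "t + 1 / (real n + 1) \<le> t + 1" by simp
    with k have "t + 1 / (real n + 1) \<le> real k" by linarith
    then have "S n \<subseteq> slab 0 (real k) i 1" using assms
      unfolding S_def slab_def by (intro Sigma_mono) auto
    then have "emeasure \<nu> (S n) \<le> emeasure \<nu> (slab 0 (real k) i 1)"
      by (rule emeasure_mono) (use sets_nu in auto)
    then show "emeasure \<nu> (S n) \<noteq> \<infinity>" using fin_nu[of k i] by (auto simp: top_unique)
  qed
  moreover have "(\<Inter>n. S n) = {}"
  proof (rule ccontr)
    assume "(\<Inter>n. S n) \<noteq> {}"
    then obtain s x u where "\<And>n. (s, x, u) \<in> S n" by fastforce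
    then have s: "t < s" "\<And>n. s \<le> t + 1 / (real n + 1)" by (auto simp: S_def slab_def)
    obtain n where "1 / real (Suc n) < s - t" using nat_approx_posE s(1) by (metis diff_gt_0_iff_gt)
    then show False using s(2)[of n] by (simp add: add.commute)
  qed
  ultimately have "(\<lambda>n. emeasure \<nu> (S n)) \<longlonglongrightarrow> 0" by simp
  then have "\<forall>\<^sub>F n in sequentially. emeasure \<nu> (S n) < 1" by (rule order_tendstoD) simp
  then obtain n where "emeasure \<nu> (S n) < 1" by (auto dest: eventually_happens)
  then have "emeasure \<nu> (S n) = 0" using enat_lt_1 m by blast
  then show ?thesis unfolding S_def by (intro exI[of _ "t + 1 / (real n + 1)"]) auto
qed

text \<open>Short time intervals after \<open>t\<close> carry no mass, so the point responsible for a birth at time \<open>t\<close> is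
  found before or at \<open>t\<close>, where the birth rate is governed by the left limit.\<close>

lemma birth_mass:
  assumes t: "0 \<le> s" "s < t" and y: "y \<in> h t" "y \<notin> lim_before h t" "y \<in> shell i"
    and w: "\<And>x. x \<in> shell i \<Longrightarrow> birth_rate a x (lim_before h t) \<le> w"
  shows "emeasure \<nu> (slab s t i w) > 0"
proof -
  have t0: "0 < t" using t by simp
  obtain s0 where s0: "0 \<le> s0" "s0 < t" "\<And>r. s0 \<le> r \<Longrightarrow> r < t \<Longrightarrow> h r = lim_before h t"
    using lim_before[OF t0] by auto
  \<comment> \<open>The configuration is constant on \<open>[s0, t)\<close>, so the rate seen by
    points with time in \<open>(s0, t]\<close> is the one at \<open>t\<close>.\<close>
  have lb: "lim_before h r = lim_before h t" if r: "s0 < r" "r \<le> t" for r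
  proof -
    obtain s1 where s1: "0 \<le> s1" "s1 < r" "\<And>p. s1 \<le> p \<Longrightarrow> p < r \<Longrightarrow> h p = lim_before h r"
      using lim_before[of r] r s0 by auto
    show ?thesis using s1(3)[of "max s0 s1"] s0(3)[of "max s0 s1"] r s1(2) by auto
  qed
  obtain d where d: "d > t" "\<And>r. t \<le> r \<Longrightarrow> r < d \<Longrightarrow> h r = h t"
    using right_const[of t] t0 by auto
  obtain d' where d': "d' > t" "emeasure \<nu> (slab t d' i 1) = 0"
    using no_mass_right[of t i] t0 by auto
  obtain q where q: "q \<in> \<rat>" "max s s0 < q" "q < t"
    using Rats_dense_in_real[of "max s s0" t] t s0 by auto
  \<comment> \<open>Below \<open>d\<close> the configuration is still \<open>h t\<close>, and below
    \<open>d'\<close> no further points interfere.\<close>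
  obtain q' where q': "q' \<in> \<rat>" "t < q'" "q' < min d d'"
    using Rats_dense_in_real[of t "min d d'"] d d' by auto
  have "y \<in> (h q' - h q) \<inter> shell i" using y d(2)[of q'] q' s0(3)[of q] q by auto
  moreover have "finite ((h q' - h q) \<inter> shell i)" using fin[of q'] q' t0 by auto
  ultimately have "card ((h q' - h q) \<inter> shell i) > 0" by (auto simp: card_gt_0_iff)
  then have "0 < (of_nat (card ((h q' - h q) \<inter> shell i)) :: ennreal)" by simp
  also have "\<dots> = emeasure \<nu> (born q' (shell i) - born q (shell i))"
    by (rule births_between) (use q q' t in auto)
  also have "\<dots> \<le> emeasure \<nu> (slab s t i w \<union> slab t d' i 1)"
  proof (rule emeasure_mono)
    show "slab s t i w \<union> slab t d' i 1 \<in> sets \<nu>"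
      unfolding sets_nu by (intro sets.Un slab_sets) (use t in auto)
    show "born q' (shell i) - born q (shell i) \<subseteq> slab s t i w \<union> slab t d' i 1"
    proof clarify
      fix r x u
      assume in': "(r, x, u) \<in> born q' (shell i)" and "(r, x, u) \<notin> born q (shell i)"
        and nb: "(r, x, u) \<notin> slab t d' i 1"
      then have r: "q < r" "r \<le> q'" "x \<in> shell i" "0 \<le> u" "u \<le> birth_rate a x (lim_before h r)"
        by (auto simp: born_def)
      have "r \<le> t" using nb r q' by (auto simp: slab_def birth_rate_def)
      then have "u \<le> w" using r lb[of r] w[of x] q by auto
      then show "(r, x, u) \<in> slab s t i w" using r \<open>r \<le> t\<close> q by (auto simp: slab_def)
    qed
  qed
  also have "\<dots> \<le> emeasure \<nu> (slab s t i w) + emeasure \<nu> (slab t d' i 1)"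
    by (rule emeasure_subadditive; unfold sets_nu; intro slab_sets) (use t in auto)
  finally show ?thesis using d' by simp
qed

section \<open>The front of a configuration\<close>

lemma zero_mem: "0 \<le> t \<Longrightarrow> 0 \<in> h t"
  using mono[of 0 t] start by auto

definition front :: "real \<Rightarrow> nat" where
  "front t = Max (blk ` h t)"

lemma blk_le_front: "0 \<le> t \<Longrightarrow> y \<in> h t \<Longrightarrow> blk y \<le> front t"
  unfolding front_def by (rule Max_ge) (simp_all add: fin)

lemma front_mono: "0 \<le> s \<Longrightarrow> s \<le> t \<Longrightarrow> front s \<le> front t"
  unfolding front_def by (rule Max_mono[OF image_mono[OF mono]]) (use zero_mem[of s] fin[of t] in auto)

lemma front_attained: "0 \<le> t \<Longrightarrow> \<exists>y\<in>h t. blk y = front t"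
proof -
  assume t: "0 \<le> t"
  have "front t \<in> blk ` h t"
    unfolding front_def by (rule Max_in) (use zero_mem[OF t] fin[OF t] in auto)
  then show ?thesis by auto
qed

lemma front_0: "front 0 = 0"
  unfolding front_def start by (simp add: blk_def)

end

section \<open>Jumps of the front\<close>

text \<open>Written as a series over all \<open>d\<close> with zero terms, so that sums over finite
  sets of distances compare termwise.\<close>

definition tail :: "real \<Rightarrow> nat \<Rightarrow> real" where
  "tail \<alpha> e = (\<Sum>d. if e < d then real d powr -\<alpha> else 0)"

lemma tail_summable:
  assumes "\<alpha> > 1"
  shows "summable (\<lambda>d. if e < d then real d powr -\<alpha> else 0)"
proof (rule summable_comparison_test[OF _ summable_real_powr_iff[THEN iffD2]])
  show "\<exists>N. \<forall>n\<ge>N. norm (if e < n then real n powr -\<alpha> else 0) \<le> real n powr -\<alpha>"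
    by (intro exI[of _ 0]) auto
qed (use assms in simp)

lemma tail_nonneg: "\<alpha> > 1 \<Longrightarrow> tail \<alpha> e \<ge> 0"
  unfolding tail_def by (intro suminf_nonneg tail_summable) auto

lemma tail_le: "\<alpha> > 1 \<Longrightarrow> tail \<alpha> e \<le> tail \<alpha> 0"
  unfolding tail_def by (intro suminf_le tail_summable) auto

lemma sum_le_tail:
  assumes "\<alpha> > 1" "finite A" "\<And>d. d \<in> A \<Longrightarrow> e < d"
  shows "(\<Sum>d\<in>A. real d powr -\<alpha>) \<le> tail \<alpha> e"
proof -
  have "(\<Sum>d\<in>A. real d powr -\<alpha>) = (\<Sum>d\<in>A. if e < d then real d powr -\<alpha> else 0)"
    using assms by (intro sum.cong) auto
  also have "\<dots> \<le> tail \<alpha> e"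
    unfolding tail_def by (intro sum_le_suminf tail_summable assms) auto
  finally show ?thesis .
qed

text \<open>Exchange the summations: \<open>d\<close> is counted for at most \<open>d\<close> values
  of \<open>e\<close>, which raises the exponent by one. The resulting series converges because
  \<open>\<alpha> > 2\<close>.\<close>

lemma sum_tail_le:
  assumes "\<alpha> > 2"
  shows "(\<Sum>e<n. tail \<alpha> e) \<le> (\<Sum>d. real d powr (1 - \<alpha>))"
proof -
  have "(\<Sum>e<n. tail \<alpha> e) = (\<Sum>d. \<Sum>e<n. if e < d then real d powr -\<alpha> else 0)"
    unfolding tail_def using assms by (intro suminf_sum[symmetric] tail_summable) auto
  also have "\<dots> \<le> (\<Sum>d. real d powr (1 - \<alpha>))"
  proof (rule suminf_le)
    show "summable (\<lambda>d. \<Sum>e<n. if e < d then real d powr -\<alpha> else 0)"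
      using assms by (intro summable_sum tail_summable) auto
    show "summable (\<lambda>d. real d powr (1 - \<alpha>))" using assms by (simp add: summable_real_powr_iff)
    fix d :: nat
    have "(\<Sum>e<n. if e < d then real d powr -\<alpha> else 0) = (\<Sum>e\<in>{..<n} \<inter> {..<d}. real d powr -\<alpha>)"
      by (subst sum.inter_restrict) simp_all
    also have "\<dots> \<le> (\<Sum>e<d. real d powr -\<alpha>)"
      by (rule sum_mono2) auto
    also have "\<dots> = real d powr (1 - \<alpha>)"
      by (cases "d = 0") (auto simp: powr_diff powr_minus divide_simps)
    finally show "(\<Sum>e<n. if e < d then real d powr -\<alpha> else 0) \<le> real d powr (1 - \<alpha>)" .
  qed
  finally show ?thesis .
qed

text \<open>Time is cut into pieces of length \<open>1 / D\<close>, so that a union bound over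
  finitely many monotone histories of the front becomes possible.\<close>

definition cell :: "nat \<Rightarrow> nat \<Rightarrow> nat \<Rightarrow> real \<Rightarrow> (real \<times> real \<times> real) set" where
  "cell D n i w = slab (real n / real D) (real (Suc n) / real D) i w"

lemma cell_sets [intro, simp]: "cell D n i w \<in> sets ambient"
  unfolding cell_def by auto

lemma cell_subset_slab:
  assumes "real (Suc n) / real D \<le> t" "w \<le> w'"
  shows "cell D n i w \<subseteq> slab 0 t i w'"
proof -
  have "0 \<le> real n / real D" by simp
  then have "0 < s \<and> s \<le> t" if "s \<in> {real n / real D<..real (Suc n) / real D}" for s
    using that assms(1) unfolding greaterThanAtMost_iff by linarith
  then have "{real n / real D<..real (Suc n) / real D} \<subseteq> {0<..t}" by auto
  then show ?thesis unfolding cell_def slab_def using assms(2) by auto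
qed

lemma sum_disjoint_le:
  fixes g :: "'b \<Rightarrow> real"
  assumes "finite S" "\<And>v. v \<in> S \<Longrightarrow> finite (A v)" "finite B" "\<And>v. v \<in> S \<Longrightarrow> A v \<subseteq> B"
    and "\<And>v w. v \<in> S \<Longrightarrow> w \<in> S \<Longrightarrow> v \<noteq> w \<Longrightarrow> A v \<inter> A w = {}" "\<And>b. b \<in> B \<Longrightarrow> 0 \<le> g b"
  shows "(\<Sum>v\<in>S. \<Sum>d\<in>A v. g d) \<le> (\<Sum>d\<in>B. g d)"
proof -
  have "(\<Sum>v\<in>S. \<Sum>d\<in>A v. g d) = (\<Sum>d\<in>(\<Union>v\<in>S. A v). g d)"
    by (rule sum.UNION_disjoint[symmetric]) (use assms in auto)
  also have "\<dots> \<le> (\<Sum>d\<in>B. g d)" by (rule sum_mono2) (use assms in auto)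
  finally show ?thesis .
qed

lemma sum_Sigma_card:
  fixes g :: "nat \<Rightarrow> nat \<Rightarrow> real"
  assumes "finite A" "\<And>n. finite (B n)" "\<And>n i. finite (C n i)"
  shows "(\<Sum>p\<in>Sigma A (\<lambda>n. Sigma (B n) (\<lambda>i. C n i)). g (fst p) (fst (snd p)))
    = (\<Sum>n\<in>A. \<Sum>i\<in>B n. real (card (C n i)) * g n i)"
proof -
  have "(\<Sum>n\<in>A. \<Sum>i\<in>B n. real (card (C n i)) * g n i)
      = (\<Sum>n\<in>A. \<Sum>i\<in>B n. \<Sum>y\<in>C n i. g n i)" by simp
  also have "\<dots> = (\<Sum>n\<in>A. \<Sum>q\<in>Sigma (B n) (\<lambda>i. C n i). g n (fst q))"
    using assms by (intro sum.cong refl) (subst sum.Sigma, auto simp: case_prod_unfold)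
  also have "\<dots> = (\<Sum>p\<in>Sigma A (\<lambda>n. Sigma (B n) (\<lambda>i. C n i)). g (fst p) (fst (snd p)))"
    using assms by (subst sum.Sigma) (auto simp: case_prod_unfold)
  finally show ?thesis by simp
qed

text \<open>The size of the kernel enters only through its nonnegativity and its decay in the
  difference of block indices.\<close>

locale front_path = growth_path +
  fixes \<alpha> c1 :: real
  assumes alpha: "\<alpha> > 2" and c1: "c1 > 0"
    and a_nonneg: "0 \<le> a z"
    and a_far: "blk y < blk x \<Longrightarrow> a (x - y) \<le> c1 * real (blk x - blk y) powr (-2 * \<alpha>)"
begin

section \<open>Jumps up to time \<open>T\<close> on a time grid of mesh \<open>1 / D\<close>\<close>

context
  fixes T D :: nat
  assumes T: "T > 0" and D: "D > 0"
begin

text \<open>Jumps are indexed by their landing shell instead of their time: the front is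
  nondecreasing, so it enters each of its values only once.\<close>

definition V where "V = front ` {0..real T}"
definition prev where "prev v = Max {w \<in> V. w < v}"
definition hit where "hit v = Inf {t \<in> {0..real T}. v \<le> front t}"
definition jump where "jump v = v - prev v"
definition sources where "sources v = lim_before h (hit v)"
text \<open>Cells are open on the left and closed on the right in time, hence the ceiling minus one.
  Nothing is truncated for positive \<open>v\<close> in \<open>V\<close>, since then
  \<open>hit v > 0\<close>.\<close>

definition tick where "tick v = nat \<lceil>hit v * real D\<rceil> - 1"

lemma finite_V: "finite V"
  unfolding V_def by (rule finite_subset[of _ "{..front (real T)}"]) (auto intro: front_mono)

lemma V_0: "0 \<in> V"
  unfolding V_def using front_0 by (intro image_eqI[of _ _ 0]) auto

lemma prev_spec:
  assumes "0 < v"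
  shows "prev v \<in> V" "prev v < v" "\<And>w. w \<in> V \<Longrightarrow> w < v \<Longrightarrow> w \<le> prev v"
proof -
  have "prev v \<in> {w \<in> V. w < v}"
    unfolding prev_def by (rule Max_in) (use finite_V V_0 assms in auto)
  then show "prev v \<in> V" "prev v < v" by auto
  show "w \<le> prev v" if "w \<in> V" "w < v" for w
    unfolding prev_def by (rule Max_ge) (use that finite_V in auto)
qed

text \<open>The infimum is attained because the configuration is constant for a short while after
  each time. Before \<open>hit v\<close> the front is below \<open>v\<close> with values in
  \<open>V\<close>, hence at most \<open>prev v\<close>.\<close>

lemma hit_spec:
  assumes "v \<in> V" "0 < v"
  shows "0 < hit v" "hit v \<le> real T" "front (hit v) = v"
    "\<And>s. 0 \<le> s \<Longrightarrow> s < hit v \<Longrightarrow> front s \<le> prev v"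
proof -
  let ?A = "{t \<in> {0..real T}. v \<le> front t}"
  obtain t1 where t1: "0 \<le> t1" "t1 \<le> real T" "front t1 = v"
    using assms by (auto simp: V_def)
  have bdd: "bdd_below ?A" by (rule bdd_belowI[of _ 0]) auto
  have ne: "?A \<noteq> {}" using t1 by auto
  have h0: "0 \<le> hit v" unfolding hit_def by (rule cInf_greatest[OF ne]) auto
  have h1: "hit v \<le> t1" unfolding hit_def by (rule cInf_lower[OF _ bdd]) (use t1 in auto)
  show hT: "hit v \<le> real T" using h1 t1 by simp
  have below: "front s < v" if "0 \<le> s" "s < hit v" for s
  proof (rule ccontr)
    assume "\<not> front s < v"
    then have "hit v \<le> s" unfolding hit_def by (intro cInf_lower[OF _ bdd]) (use that hT in auto)
    then show False using that by simp
  qed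
  have ge: "v \<le> front (hit v)"
  proof -
    obtain d where d: "d > hit v" "\<And>r. hit v \<le> r \<Longrightarrow> r < d \<Longrightarrow> h r = h (hit v)"
      using right_const[OF h0] by auto
    have "Inf ?A < d" using d(1) by (simp add: hit_def)
    then obtain t where t: "t \<in> ?A" "t < d" using cInf_lessD[OF ne] by blast
    have "hit v \<le> t" unfolding hit_def by (rule cInf_lower[OF t(1) bdd])
    then have "front t = front (hit v)" using d(2)[of t] t by (simp add: front_def)
    then show ?thesis using t by simp
  qed
  show "front (hit v) = v" using ge front_mono[OF h0 h1] t1 by simp
  show "0 < hit v" using ge assms front_0 h0 by (cases "hit v = 0") auto
  show "front s \<le> prev v" if "0 \<le> s" "s < hit v" for s
  proof -
    have "front s \<in> V" unfolding V_def using that hT by auto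
    then show ?thesis using prev_spec(3)[OF assms(2)] below[OF that] by auto
  qed
qed

lemma hit_mono:
  assumes "v \<in> V" "w \<in> V" "0 < v" "v \<le> w"
  shows "hit v \<le> hit w"
proof (rule ccontr)
  assume "\<not> hit v \<le> hit w"
  then have "front (hit w) \<le> prev v" using hit_spec(1)[of w] assms by (intro hit_spec(4)) auto
  then show False using hit_spec(3)[of w] prev_spec(2)[of v] assms by auto
qed

lemma tick_spec:
  assumes "v \<in> V" "0 < v"
  shows "real (tick v) / real D < hit v" "hit v \<le> real (Suc (tick v)) / real D" "tick v < T * D"
proof -
  have pos: "0 < hit v * real D" using hit_spec(1)[OF assms] D by simp
  then have c: "\<lceil>hit v * real D\<rceil> \<ge> 1" by linarith
  have n: "real (Suc (tick v)) = real_of_int \<lceil>hit v * real D\<rceil>" unfolding tick_def using c by simp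
  have "real (tick v) < hit v * real D" using n by simp linarith
  then show "real (tick v) / real D < hit v" using D by (simp add: divide_less_eq)
  have "hit v * real D \<le> real (Suc (tick v))" unfolding n by (rule le_of_int_ceiling)
  then show "hit v \<le> real (Suc (tick v)) / real D" using D by (simp add: le_divide_eq)
  have "hit v * real D \<le> real (T * D)" using hit_spec(2)[OF assms] by (simp add: mult_right_mono)
  then have "\<lceil>hit v * real D\<rceil> \<le> int (T * D)" by (simp add: ceiling_le_iff)
  then have "real_of_int \<lceil>hit v * real D\<rceil> \<le> real (T * D)" by (metis of_int_le_iff of_int_of_nat_eq)
  then show "tick v < T * D" unfolding n[symmetric] by linarith
qed

lemma tick_mono:
  assumes "v \<in> V" "w \<in> V" "0 < v" "v \<le> w"
  shows "tick v \<le> tick w"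
  unfolding tick_def
  by (intro diff_le_mono nat_mono ceiling_mono mult_right_mono hit_mono assms) simp

text \<open>A source was born strictly before \<open>hit v\<close>. So a time at which it is still
  absent also precedes \<open>hit v\<close>, when the front had not passed
  \<open>prev v\<close>.\<close>

lemma sources_facts:
  assumes "v \<in> V" "0 < v" "y \<in> sources v"
  shows "y \<in> h (real T)" "blk y \<le> prev v"
    "\<And>s. 0 \<le> s \<Longrightarrow> y \<notin> h s \<Longrightarrow> front s \<le> prev v"
proof -
  obtain q where q: "0 \<le> q" "q < hit v" "y \<in> h q"
    using assms(3) hit_spec(1)[OF assms(1,2)] unfolding sources_def by (auto simp: lim_before_mem)
  show "y \<in> h (real T)" using mono[of q "real T"] q hit_spec(2)[OF assms(1,2)] by auto
  show "blk y \<le> prev v"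
    using blk_le_front[OF q(1,3)] hit_spec(4)[OF assms(1,2) q(1,2)] by simp
  show "front s \<le> prev v" if "0 \<le> s" "y \<notin> h s" for s
  proof (rule hit_spec(4)[OF assms(1,2) that(1)])
    show "s < hit v" using that q mono[of q s] by (cases "s \<le> q") auto
  qed
qed

lemma finite_sources: "v \<in> V \<Longrightarrow> 0 < v \<Longrightarrow> finite (sources v)"
  using sources_facts(1) fin[of "real T"] by (meson finite_subset of_nat_0_le_iff subsetI)

lemma jump_pos: "0 < v \<Longrightarrow> 0 < jump v"
  using prev_spec(2) by (simp add: jump_def)

text \<open>The good and the bad jumps; in the second case \<open>1 < jump\<^sup>\<alpha> \<cdot> c\<^sub>1 \<Sum>\<^sub>y d\<^sub>y\<^sup>-\<^sup>2\<^sup>\<alpha>\<close> with \<open>jump \<le> d\<^sub>y\<close>.\<close>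

lemma jump_cases:
  assumes v: "v \<in> V" "0 < v"
  shows "emeasure \<nu> (cell D (tick v) v (real (jump v) powr -\<alpha>)) > 0 \<or>
    real (jump v) \<le> c1 * (\<Sum>y\<in>sources v. real (jump v) * real (v - blk y) powr -\<alpha>)"
proof (cases "c1 * (\<Sum>y\<in>sources v. real (v - blk y) powr (-2 * \<alpha>)) \<le> real (jump v) powr -\<alpha>")
  case True
  have hv: "0 < hit v" using hit_spec(1)[OF v] .
  obtain y where y: "y \<in> h (hit v)" "blk y = v"
    using front_attained[of "hit v"] hit_spec(3)[OF v] hv by auto
  \<comment> \<open>The particle realising the new front is absent just before, so it is born
    exactly at \<open>hit v\<close>, as \<open>birth_mass\<close> requires.\<close>
  have "y \<notin> sources v" using sources_facts(2)[OF v] y prev_spec(2)[OF v(2)] by fastforce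
  then have "emeasure \<nu> (slab (real (tick v) / real D) (hit v) v (real (jump v) powr -\<alpha>)) > 0"
  proof (intro birth_mass)
    show "y \<in> shell v" using y by (simp add: shell_def)
    fix x assume x: "x \<in> shell v"
    have "birth_rate a x (sources v) \<le> (\<Sum>y\<in>sources v. a (x - y))" by (simp add: birth_rate_def)
    also have "\<dots> \<le> (\<Sum>y\<in>sources v. c1 * real (v - blk y) powr (-2 * \<alpha>))"
    proof (rule sum_mono)
      fix y assume "y \<in> sources v"
      then have "blk y < v" using sources_facts(2)[OF v] prev_spec(2)[OF v(2)] by fastforce
      then show "a (x - y) \<le> c1 * real (v - blk y) powr (-2 * \<alpha>)"
        using a_far[of y x] x by (simp add: shell_def)
    qed
    finally show "birth_rate a x (lim_before h (hit v)) \<le> real (jump v) powr -\<alpha>"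
      using True by (simp add: sum_distrib_left sources_def)
  qed (use y tick_spec[OF v] in \<open>auto simp: sources_def\<close>)
  also have "\<dots> \<le> emeasure \<nu> (cell D (tick v) v (real (jump v) powr -\<alpha>))"
  proof (rule emeasure_mono)
    show "slab (real (tick v) / real D) (hit v) v (real (jump v) powr -\<alpha>)
        \<subseteq> cell D (tick v) v (real (jump v) powr -\<alpha>)"
      using tick_spec[OF v] by (auto simp: cell_def slab_def)
  qed (simp add: sets_nu)
  finally show ?thesis by simp
next
  case False
  define r where "r = real (jump v)"
  have r: "r > 0" using jump_pos[OF v(2)] by (simp add: r_def)
  have "r = r * r powr \<alpha> * r powr -\<alpha>" using r by (simp add: powr_minus field_simps)
  also have "\<dots> \<le> r * r powr \<alpha> * (c1 * (\<Sum>y\<in>sources v. real (v - blk y) powr (-2 * \<alpha>)))"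
    using False r by (intro mult_left_mono) (auto simp: r_def)
  also have "\<dots> = c1 * (\<Sum>y\<in>sources v. r * (r powr \<alpha> * real (v - blk y) powr (-2 * \<alpha>)))"
    by (simp add: sum_distrib_left mult_ac)
  also have "\<dots> \<le> c1 * (\<Sum>y\<in>sources v. r * real (v - blk y) powr -\<alpha>)"
  proof (intro mult_left_mono sum_mono)
    fix y assume y: "y \<in> sources v"
    let ?d = "real (v - blk y)"
    have d: "r \<le> ?d" "?d > 0"
      using sources_facts(2)[OF v y] prev_spec(2)[OF v(2)] by (auto simp: r_def jump_def)
    have "r powr \<alpha> * ?d powr (-2 * \<alpha>) \<le> ?d powr \<alpha> * ?d powr (-2 * \<alpha>)"
      using d r alpha by (intro mult_right_mono powr_mono2) auto
    also have "\<dots> = ?d powr -\<alpha>" using d by (simp flip: powr_add)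
    finally show "r powr \<alpha> * ?d powr (-2 * \<alpha>) \<le> ?d powr -\<alpha>" .
  qed (use r c1 in auto)
  finally show ?thesis by (simp add: r_def)
qed

section \<open>Total length of the jumps that start below a level\<close>

lemma jumps_disjoint:
  assumes "v \<in> V" "w \<in> V" "0 < v" "0 < w" "v \<noteq> w"
  shows "{prev v<..v} \<inter> {prev w<..w} = {}"
  using assms prev_spec(3)[of v w] prev_spec(3)[of w v] by (cases "v < w") force+

text \<open>Only the starting point is constrained: the last of these jumps may land beyond
  \<open>L\<close>.\<close>

definition crossed :: "nat \<Rightarrow> nat set" where
  "crossed L = {v \<in> V. 0 < v \<and> prev v < L}"

text \<open>Each \<open>d\<close> in \<open>{0<..L}\<close> is passed by the jump landing at the
  least element of \<open>V\<close> that is at least \<open>d\<close>.\<close>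

lemma crossed_sum:
  assumes "L \<le> front (real T)"
  shows "L \<le> (\<Sum>v\<in>crossed L. jump v)"
proof -
  have fc: "finite (crossed L)" using finite_V by (simp add: crossed_def)
  have "{0<..L} \<subseteq> (\<Union>v\<in>crossed L. {prev v<..v})"
  proof
    fix d assume d: "d \<in> {0<..L}"
    let ?B = "{w \<in> V. d \<le> w}"
    have "front (real T) \<in> V" unfolding V_def by auto
    then have ne: "?B \<noteq> {}" using assms d by fastforce
    define v where "v = Min ?B"
    have vB: "v \<in> ?B" unfolding v_def by (rule Min_in) (use finite_V ne in auto)
    then have v: "v \<in> V" "d \<le> v" "0 < v" using d by auto
    have "prev v < d"
    proof (rule ccontr)
      assume "\<not> prev v < d"
      then have "v \<le> prev v"
        unfolding v_def by (intro Min_le) (use finite_V prev_spec(1)[OF v(3)] in \<open>auto simp: v_def\<close>)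
      then show False using prev_spec(2)[OF v(3)] by simp
    qed
    then show "d \<in> (\<Union>v\<in>crossed L. {prev v<..v})" using v d by (auto simp: crossed_def)
  qed
  then have "card {0<..L} \<le> card (\<Union>v\<in>crossed L. {prev v<..v})"
    by (intro card_mono) (use fc in auto)
  also have "\<dots> \<le> (\<Sum>v\<in>crossed L. card {prev v<..v})" by (rule card_UN_le[OF fc])
  finally show ?thesis by (simp add: jump_def)
qed

text \<open>A jump of length \<open>r\<close> landing at distance \<open>d\<close> from shell \<open>i\<close> has \<open>r d\<^sup>-\<^sup>\<alpha>\<close> bounded by the sum of \<open>e\<^sup>-\<^sup>\<alpha>\<close> over
  the distances \<open>e\<close> jumped over, and different jumps cover different distances.\<close>

lemma weight_sum:
  assumes "S \<subseteq> V" "\<And>v. v \<in> S \<Longrightarrow> 0 < v \<and> g \<le> prev v" "i \<le> g"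
  shows "(\<Sum>v\<in>S. real (jump v) * real (v - i) powr -\<alpha>) \<le> tail \<alpha> (g - i)"
proof -
  have fS: "finite S" using assms(1) finite_V by (rule finite_subset)
  let ?A = "\<lambda>v. {prev v<..v}"
  define B where "B = (\<Union>v\<in>S. ?A v)"
  have "(\<Sum>v\<in>S. real (jump v) * real (v - i) powr -\<alpha>) \<le> (\<Sum>v\<in>S. \<Sum>d\<in>?A v. real (d - i) powr -\<alpha>)"
  proof (rule sum_mono)
    fix v assume v: "v \<in> S"
    have "real (jump v) * real (v - i) powr -\<alpha> = (\<Sum>d\<in>?A v. real (v - i) powr -\<alpha>)"
      by (simp add: jump_def)
    also have "\<dots> \<le> (\<Sum>d\<in>?A v. real (d - i) powr -\<alpha>)"
      using assms(2)[OF v] assms(3) alpha by (intro sum_mono powr_mono2') auto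
    finally show "real (jump v) * real (v - i) powr -\<alpha> \<le> (\<Sum>d\<in>?A v. real (d - i) powr -\<alpha>)" .
  qed
  also have "\<dots> \<le> (\<Sum>d\<in>B. real (d - i) powr -\<alpha>)"
    using fS jumps_disjoint assms(1,2) by (intro sum_disjoint_le) (auto simp: B_def subset_iff)
  \<comment> \<open>All elements of \<open>B\<close> exceed \<open>i\<close>, so the truncated
    subtraction is injective on \<open>B\<close>.\<close>
  also have "\<dots> = (\<Sum>e\<in>(\<lambda>d. d - i) ` B. real e powr -\<alpha>)"
    by (subst sum.reindex) (use assms in \<open>force simp: B_def inj_on_def\<close>)+
  also have "\<dots> \<le> tail \<alpha> (g - i)"
    by (rule sum_le_tail) (use alpha assms fS in \<open>fastforce simp: B_def\<close>)+
  finally show ?thesis .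
qed

text \<open>The subtraction \<open>j n - i\<close> is truncated: a particle born outside the front of time \<open>n / D\<close> gets the
  full weight \<open>tail \<alpha> 0\<close>.\<close>

lemma bad_sum:
  fixes L :: nat
  defines "j \<equiv> \<lambda>n. min (front (real n / real D)) L"
  shows "(\<Sum>v\<in>crossed L. \<Sum>y\<in>sources v. real (jump v) * real (v - blk y) powr -\<alpha>)
    \<le> tail \<alpha> 0 + (\<Sum>n<T * D. \<Sum>i\<le>j (Suc n). enn2real (emeasure \<nu> (cell D n i 1)) * tail \<alpha> (j n - i))"
proof -
  define C where "C = crossed L"
  have C: "finite C" "C \<subseteq> V" "\<And>v. v \<in> C \<Longrightarrow> v \<in> V \<and> 0 < v \<and> prev v < L"
    using finite_V by (auto simp: C_def crossed_def)
  define Y where "Y = (\<Union>v\<in>C. sources v)"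
  have Y: "finite Y" using C finite_sources by (auto simp: Y_def)
  \<comment> \<open>The sum is regrouped by source: \<open>f y\<close> is the contribution of
    \<open>y\<close> to all jumps together.\<close>
  define f where "f y = (\<Sum>v\<in>{v \<in> C. y \<in> sources v}. real (jump v) * real (v - blk y) powr -\<alpha>)" for y
  define \<tau> where "\<tau> n = real n / real D" for n :: nat
  have tau: "0 \<le> \<tau> n" "\<tau> n \<in> \<rat>" "\<tau> n \<le> \<tau> (Suc n)" for n
    by (auto simp: \<tau>_def divide_right_mono)
  have "(\<Sum>v\<in>C. \<Sum>y\<in>sources v. real (jump v) * real (v - blk y) powr -\<alpha>)
      = (\<Sum>v\<in>C. \<Sum>y\<in>Y. if y \<in> sources v then real (jump v) * real (v - blk y) powr -\<alpha> else 0)"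
  proof (rule sum.cong[OF refl])
    fix v assume "v \<in> C"
    then have "Y \<inter> sources v = sources v" by (auto simp: Y_def)
    then show "(\<Sum>y\<in>sources v. real (jump v) * real (v - blk y) powr -\<alpha>)
        = (\<Sum>y\<in>Y. if y \<in> sources v then real (jump v) * real (v - blk y) powr -\<alpha> else 0)"
      using sum.inter_restrict[OF Y, of "\<lambda>y. real (jump v) * real (v - blk y) powr -\<alpha>" "sources v"]
      by simp
  qed
  also have "\<dots> = (\<Sum>y\<in>Y. f y)"
    unfolding f_def using C(1) by (subst sum.swap) (simp add: sum.inter_filter)
  \<comment> \<open>The initial particle is not a birth and is counted in no cell, so it is bounded
    separately.\<close>
  also have "\<dots> \<le> f 0 + (\<Sum>y\<in>Y - {0}. f y)"
    using Y by (cases "0 \<in> Y") (auto simp: sum.remove f_def intro!: sum_nonneg)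
  also have "f 0 \<le> tail \<alpha> 0"
    using weight_sum[of "{v \<in> C. 0 \<in> sources v}" 0 0] C by (auto simp: f_def blk_def)
  \<comment> \<open>Every other source is charged to the grid interval and the shell of its
    birth.\<close>
  also have "(\<Sum>y\<in>Y - {0}. f y) \<le> (\<Sum>p\<in>Sigma {..<T * D} (\<lambda>n. Sigma {..j (Suc n)}
      (\<lambda>i. (h (\<tau> (Suc n)) - h (\<tau> n)) \<inter> shell i)). tail \<alpha> (j (fst p) - fst (snd p)))"
  proof (rule sum_le_included[where i = "\<lambda>p. snd (snd p)"])
    show "finite (Sigma {..<T * D} (\<lambda>n. Sigma {..j (Suc n)} (\<lambda>i. (h (\<tau> (Suc n)) - h (\<tau> n)) \<inter> shell i)))"
      using fin tau by (intro finite_SigmaI) auto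
    show "\<forall>p\<in>Sigma {..<T * D} (\<lambda>n. Sigma {..j (Suc n)} (\<lambda>i. (h (\<tau> (Suc n)) - h (\<tau> n)) \<inter> shell i)).
        0 \<le> tail \<alpha> (j (fst p) - fst (snd p))"
      using tail_nonneg alpha by auto
    show "\<forall>y\<in>Y - {0}. \<exists>p\<in>Sigma {..<T * D} (\<lambda>n. Sigma {..j (Suc n)}
        (\<lambda>i. (h (\<tau> (Suc n)) - h (\<tau> n)) \<inter> shell i)). snd (snd p) = y \<and> f y \<le> tail \<alpha> (j (fst p) - fst (snd p))"
    proof
      fix y assume y: "y \<in> Y - {0}"
      then obtain v where v: "v \<in> C" "y \<in> sources v" by (auto simp: Y_def)
      have vV: "v \<in> V" "0 < v" "prev v < L" using C(3)[OF v(1)] by auto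
      define n' where "n' = (LEAST n. y \<in> h (\<tau> n))"
      have yT: "y \<in> h (\<tau> (T * D))" using sources_facts(1)[OF vV(1,2) v(2)] D by (simp add: \<tau>_def)
      have n': "y \<in> h (\<tau> n')" "n' \<le> T * D"
        unfolding n'_def by (rule LeastI[where P = "\<lambda>n. y \<in> h (\<tau> n)", OF yT], rule Least_le[where P = "\<lambda>n. y \<in> h (\<tau> n)", OF yT])
      have "n' \<noteq> 0" using n'(1) y start by (cases "n' = 0") (auto simp: \<tau>_def)
      then obtain n where n: "n' = Suc n" using not0_implies_Suc by blast
      have yn: "y \<notin> h (\<tau> n)" using not_less_Least[of n "\<lambda>n. y \<in> h (\<tau> n)"] n by (simp add: n'_def)
      \<comment> \<open>At the last grid time before its birth, \<open>y\<close> is absent, so all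
        jumps that it feeds start at or beyond the front of that time.\<close>
      have fn: "front (\<tau> n) \<le> prev w" if "w \<in> C" "y \<in> sources w" for w
        using sources_facts(3)[of w y "\<tau> n"] that C(3)[OF that(1)] tau yn by auto
      \<comment> \<open>Since \<open>prev v < L\<close>, the cap at \<open>L\<close> is inactive
        here.\<close>
      then have jn: "j n = front (\<tau> n)" using v vV by (fastforce simp: j_def \<tau>_def)
      have by1: "blk y \<le> prev w" if "w \<in> C" "y \<in> sources w" for w
        using sources_facts(2)[of w y] that C(3)[OF that(1)] by auto
      have "blk y \<le> j (Suc n)"
        using by1[OF v] vV blk_le_front[of "\<tau> n'" y] n' n tau by (auto simp: j_def \<tau>_def)
      then have mem: "(n, blk y, y) \<in> Sigma {..<T * D} (\<lambda>n. Sigma {..j (Suc n)}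
          (\<lambda>i. (h (\<tau> (Suc n)) - h (\<tau> n)) \<inter> shell i))"
        using n' n yn by (auto simp: shell_def)
      \<comment> \<open>The maximum ensures \<open>i \<le> g\<close> in \<open>weight_sum\<close>;
        if \<open>y\<close> is born beyond the front, the difference is 0 and the weight is
        \<open>tail \<alpha> 0\<close>.\<close>
      have "f y \<le> tail \<alpha> (max (blk y) (front (\<tau> n)) - blk y)"
        unfolding f_def by (rule weight_sum) (use C(2,3) fn by1 in auto)
      also have "max (blk y) (front (\<tau> n)) - blk y = j n - blk y" using jn by auto
      finally show "\<exists>p\<in>Sigma {..<T * D} (\<lambda>n. Sigma {..j (Suc n)}
        (\<lambda>i. (h (\<tau> (Suc n)) - h (\<tau> n)) \<inter> shell i)). snd (snd p) = y \<and> f y \<le> tail \<alpha> (j (fst p) - fst (snd p))"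
        by (intro bexI[OF _ mem]) auto
    qed
  qed (use Y in auto)
  also have "(\<Sum>p\<in>Sigma {..<T * D} (\<lambda>n. Sigma {..j (Suc n)}
      (\<lambda>i. (h (\<tau> (Suc n)) - h (\<tau> n)) \<inter> shell i)). tail \<alpha> (j (fst p) - fst (snd p)))
    = (\<Sum>n<T * D. \<Sum>i\<le>j (Suc n). real (card ((h (\<tau> (Suc n)) - h (\<tau> n)) \<inter> shell i)) * tail \<alpha> (j n - i))"
    using fin tau by (intro sum_Sigma_card[where g = "\<lambda>n i. tail \<alpha> (j n - i)"]) auto
  also have "\<dots> \<le> (\<Sum>n<T * D. \<Sum>i\<le>j (Suc n). enn2real (emeasure \<nu> (cell D n i 1)) * tail \<alpha> (j n - i))"
  proof (intro sum_mono mult_right_mono)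
    fix n i
    have le: "of_nat (card ((h (\<tau> (Suc n)) - h (\<tau> n)) \<inter> shell i)) \<le> emeasure \<nu> (cell D n i 1)"
      using births_between_le[of "\<tau> n" "\<tau> (Suc n)" i] tau by (simp add: cell_def \<tau>_def)
    obtain k where k: "\<tau> (Suc n) \<le> real k" using real_arch_simple by blast
    have "emeasure \<nu> (cell D n i 1) \<le> emeasure \<nu> (slab 0 (real k) i 1)"
      using k by (intro emeasure_mono cell_subset_slab) (simp_all add: sets_nu \<tau>_def slab_sets)
    then have "emeasure \<nu> (cell D n i 1) < top" using fin_nu[of k i] by (simp add: le_less_trans)
    then show "real (card ((h (\<tau> (Suc n)) - h (\<tau> n)) \<inter> shell i)) \<le> enn2real (emeasure \<nu> (cell D n i 1))"
      using enn2real_mono[OF le] by (simp add: ennreal_of_nat_eq_real_of_nat)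
    show "0 \<le> tail \<alpha> (j n - i)" using tail_nonneg alpha by auto
  qed
  finally show ?thesis by (simp add: C_def)
qed

text \<open>In \<open>E1\<close> the subtraction \<open>v - L\<close> is truncated, so that only shells beyond \<open>L\<close> have a smaller mark bound.\<close>

lemma good_sum:
  fixes L M :: nat and k :: "nat \<Rightarrow> nat"
  assumes M: "2 ^ Suc M \<le> L"
    and E1: "\<And>v. emeasure \<nu> (slab 0 (real T) v (max (2 ^ Suc M) (real (v - L)) powr -\<alpha>)) = 0"
    and E2: "\<And>m S f. \<lbrakk>m \<le> M; S \<subseteq> {..<2 * L}; card S = k m; mono_on S f; f ` S \<subseteq> {..<T * D}\<rbrakk>
        \<Longrightarrow> \<exists>v\<in>S. emeasure \<nu> (cell D (f v) v ((2 ^ m) powr -\<alpha>)) = 0"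
    and k: "\<And>m. 0 < k m"
  defines "G \<equiv> {v \<in> crossed L. emeasure \<nu> (cell D (tick v) v (real (jump v) powr -\<alpha>)) > 0}"
  shows "(\<Sum>v\<in>G. real (jump v)) \<le> (\<Sum>m\<le>M. 2 ^ Suc m * real (k m - 1))"
proof -
  have G: "finite G" "\<And>v. v \<in> G \<Longrightarrow> v \<in> V \<and> 0 < v \<and> prev v < L"
    using finite_V by (auto simp: G_def crossed_def)
  \<comment> \<open>A longer jump has length at least \<open>max (2 ^ Suc M) (v - L)\<close>, as it
    starts below \<open>L\<close>; its good point would then have a mark forbidden by
    \<open>E1\<close>.\<close>
  have small: "jump v < 2 ^ Suc M" if v: "v \<in> G" for v
  proof (rule ccontr)
    assume "\<not> jump v < 2 ^ Suc M"
    then have "(2 :: nat) ^ Suc M \<le> jump v" by simp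
    then have "(2 :: real) ^ Suc M \<le> real (jump v)"
      by (metis of_nat_le_iff of_nat_numeral of_nat_power)
    moreover have "v - L \<le> jump v" using G(2)[OF v] unfolding jump_def by (intro diff_le_mono2) simp
    ultimately have "real (jump v) powr -\<alpha> \<le> max (2 ^ Suc M) (real (v - L)) powr -\<alpha>"
      using alpha by (intro powr_mono2') (auto simp: less_max_iff_disj)
    moreover have "real (Suc (tick v)) / real D \<le> real T"
    proof -
      have "Suc (tick v) \<le> T * D" using tick_spec(3)[of v] G(2)[OF v] by auto
      then have "real (Suc (tick v)) \<le> real T * real D" by (metis of_nat_le_iff of_nat_mult)
      then show ?thesis using D by (simp add: divide_le_eq)
    qed
    ultimately have "cell D (tick v) v (real (jump v) powr -\<alpha>)
        \<subseteq> slab 0 (real T) v (max (2 ^ Suc M) (real (v - L)) powr -\<alpha>)"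
      by (intro cell_subset_slab)
    then have "emeasure \<nu> (cell D (tick v) v (real (jump v) powr -\<alpha>)) \<le> 0"
      unfolding E1[of v, symmetric] by (intro emeasure_mono) (simp_all add: sets_nu slab_sets)
    then show False using v by (simp add: G_def)
  qed
  define Gm where "Gm m = {v \<in> G. 2 ^ m \<le> jump v \<and> jump v < 2 ^ Suc m}" for m
  have fGm: "finite (Gm m)" for m using G by (simp add: Gm_def)
  \<comment> \<open>Otherwise \<open>k m\<close> of these landing shells, with their nondecreasing
    ticks, would form a chain excluded by \<open>E2\<close>.\<close>
  have card_Gm: "card (Gm m) \<le> k m - 1" if m: "m \<le> M" for m
  proof (rule ccontr)
    assume "\<not> card (Gm m) \<le> k m - 1"
    then have "k m \<le> card (Gm m)" by simp
    then obtain S where S: "S \<subseteq> Gm m" "card S = k m" by (meson obtain_subset_with_card_n)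
    have SG: "v \<in> G" if "v \<in> S" for v using that S by (auto simp: Gm_def)
    \<comment> \<open>A jump starts below \<open>L\<close> and is shorter than
      \<open>2 ^ Suc M \<le> L\<close>.\<close>
    have "S \<subseteq> {..<2 * L}"
    proof
      fix v assume "v \<in> S"
      note v = SG[OF this]
      have "v = prev v + jump v" using prev_spec(2)[of v] G(2)[OF v] by (simp add: jump_def)
      then show "v \<in> {..<2 * L}" using small[OF v] G(2)[OF v] M by simp
    qed
    moreover have "mono_on S tick"
      using SG G(2) by (intro mono_onI tick_mono) auto
    moreover have "tick ` S \<subseteq> {..<T * D}" using SG G(2) tick_spec(3) by auto
    ultimately obtain v where v: "v \<in> S" "emeasure \<nu> (cell D (tick v) v ((2 ^ m) powr -\<alpha>)) = 0"
      using E2[OF m _ S(2)] by blast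
    have "2 ^ m \<le> jump v" using v S by (auto simp: Gm_def)
    then have "(2 :: real) ^ m \<le> real (jump v)"
      by (metis of_nat_le_iff of_nat_numeral of_nat_power)
    then have "real (jump v) powr -\<alpha> \<le> (2 ^ m) powr -\<alpha>"
      using alpha by (intro powr_mono2') auto
    then have "cell D (tick v) v (real (jump v) powr -\<alpha>) \<subseteq> cell D (tick v) v ((2 ^ m) powr -\<alpha>)"
      by (auto simp: cell_def slab_def)
    then have "emeasure \<nu> (cell D (tick v) v (real (jump v) powr -\<alpha>)) \<le> 0"
      unfolding v(2)[symmetric] by (intro emeasure_mono) (simp_all add: sets_nu)
    then show False using SG[OF v(1)] by (simp add: G_def)
  qed
  have "G \<subseteq> (\<Union>m\<le>M. Gm m)"
  proof
    fix v assume v: "v \<in> G"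
    have "0 < jump v" using jump_pos G(2)[OF v] by auto
    then obtain m where m: "2 ^ m \<le> jump v" "jump v < 2 ^ Suc m"
      using ex_power_ivl1[of 2 "jump v"] by auto
    have "(2 :: nat) ^ m < 2 ^ Suc M" using m(1) small[OF v] by simp
    then have "m \<le> M" using power_less_imp_less_exp[of "2 :: nat" m "Suc M"] by simp
    then show "v \<in> (\<Union>m\<le>M. Gm m)" using m v by (auto simp: Gm_def)
  qed
  then have "(\<Sum>v\<in>G. real (jump v)) \<le> (\<Sum>p\<in>Sigma {..M} Gm. real (jump (snd p)))"
    using G(1) fGm by (intro sum_le_included[where i = snd]) fastforce+
  also have "\<dots> = (\<Sum>m\<le>M. \<Sum>v\<in>Gm m. real (jump v))"
    using fGm by (subst sum.Sigma) (auto simp: case_prod_unfold)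
  also have "\<dots> \<le> (\<Sum>m\<le>M. 2 ^ Suc m * real (k m - 1))"
  proof (rule sum_mono)
    fix m assume m: "m \<in> {..M}"
    have "(\<Sum>v\<in>Gm m. real (jump v)) \<le> (\<Sum>v\<in>Gm m. 2 ^ Suc m)"
    proof (rule sum_mono)
      fix v assume "v \<in> Gm m"
      then have "jump v \<le> 2 ^ Suc m" by (simp add: Gm_def)
      then show "real (jump v) \<le> 2 ^ Suc m" by (metis of_nat_le_iff of_nat_numeral of_nat_power)
    qed
    also have "\<dots> = 2 ^ Suc m * real (card (Gm m))" by simp
    also have "\<dots> \<le> 2 ^ Suc m * real (k m - 1)"
      using card_Gm[of m] m by (intro mult_left_mono) auto
    finally show "(\<Sum>v\<in>Gm m. real (jump v)) \<le> 2 ^ Suc m * real (k m - 1)" .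
  qed
  finally show ?thesis .
qed

text \<open>If the front reached \<open>L\<close>, the jumps starting below \<open>L\<close> would
  have total length at least \<open>L\<close>. By \<open>good_sum\<close> and \<open>bad_sum\<close>
  the good and bad ones together fall short of it. \<open>E1\<close> to \<open>E3\<close> are the
  conditions whose failure is shown to be improbable later.\<close>

lemma front_less:
  fixes L M :: nat and k :: "nat \<Rightarrow> nat" and S :: real
  assumes M: "2 ^ Suc M \<le> L"
    and E1: "\<And>v. emeasure \<nu> (slab 0 (real T) v (max (2 ^ Suc M) (real (v - L)) powr -\<alpha>)) = 0"
    and E2: "\<And>m S f. \<lbrakk>m \<le> M; S \<subseteq> {..<2 * L}; card S = k m; mono_on S f; f ` S \<subseteq> {..<T * D}\<rbrakk>
        \<Longrightarrow> \<exists>v\<in>S. emeasure \<nu> (cell D (f v) v ((2 ^ m) powr -\<alpha>)) = 0"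
    and k: "\<And>m. 0 < k m"
    and E3: "\<And>j. \<lbrakk>mono_on {..T * D} j; j ` {..T * D} \<subseteq> {..L}\<rbrakk> \<Longrightarrow>
        (\<Sum>n<T * D. \<Sum>i\<le>j (Suc n). enn2real (emeasure \<nu> (cell D n i 1)) * tail \<alpha> (j n - i)) < S"
    and total: "(\<Sum>m\<le>M. 2 ^ Suc m * real (k m - 1)) + c1 * (tail \<alpha> 0 + S) \<le> real L"
  shows "front (real T) < L"
proof (rule ccontr)
  assume "\<not> front (real T) < L"
  then have L: "L \<le> front (real T)" by simp
  define G where "G = {v \<in> crossed L. emeasure \<nu> (cell D (tick v) v (real (jump v) powr -\<alpha>)) > 0}"
  define j where "j n = min (front (real n / real D)) L" for n
  have fc: "finite (crossed L)" using finite_V by (simp add: crossed_def)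
  have cr: "v \<in> V" "0 < v" if "v \<in> crossed L" for v using that by (auto simp: crossed_def)
  have "(\<Sum>v\<in>crossed L - G. real (jump v))
      \<le> (\<Sum>v\<in>crossed L - G. c1 * (\<Sum>y\<in>sources v. real (jump v) * real (v - blk y) powr -\<alpha>))"
  proof (rule sum_mono)
    fix v assume "v \<in> crossed L - G"
    then show "real (jump v) \<le> c1 * (\<Sum>y\<in>sources v. real (jump v) * real (v - blk y) powr -\<alpha>)"
      using jump_cases[of v] cr[of v] unfolding G_def by blast
  qed
  also have "\<dots> \<le> (\<Sum>v\<in>crossed L. c1 * (\<Sum>y\<in>sources v. real (jump v) * real (v - blk y) powr -\<alpha>))"
    using fc c1 by (intro sum_mono2) (auto intro!: mult_nonneg_nonneg sum_nonneg)
  also have "\<dots> = c1 * (\<Sum>v\<in>crossed L. \<Sum>y\<in>sources v. real (jump v) * real (v - blk y) powr -\<alpha>)"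
    by (simp add: sum_distrib_left)
  also have "\<dots> \<le> c1 * (tail \<alpha> 0 + (\<Sum>n<T * D. \<Sum>i\<le>j (Suc n).
      enn2real (emeasure \<nu> (cell D n i 1)) * tail \<alpha> (j n - i)))"
    using bad_sum[of L] c1 by (simp add: j_def)
  also have "\<dots> < c1 * (tail \<alpha> 0 + S)"
    using c1 by (intro mult_strict_left_mono add_strict_left_mono E3)
      (auto simp: j_def intro!: mono_onI min.mono front_mono divide_right_mono)
  finally have bad: "(\<Sum>v\<in>crossed L - G. real (jump v)) < c1 * (tail \<alpha> 0 + S)" .
  have good: "(\<Sum>v\<in>G. real (jump v)) \<le> (\<Sum>m\<le>M. 2 ^ Suc m * real (k m - 1))"
    unfolding G_def by (rule good_sum[OF M E1 E2 k])
  have "real L \<le> real (\<Sum>v\<in>crossed L. jump v)" using crossed_sum[OF L] by (simp only: of_nat_le_iff)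
  also have "\<dots> = (\<Sum>v\<in>G. real (jump v)) + (\<Sum>v\<in>crossed L - G. real (jump v))"
    unfolding of_nat_sum using sum.subset_diff[of G "crossed L" "\<lambda>v. real (jump v)"] fc
    by (auto simp: G_def)
  finally show False using bad good total by linarith
qed

end

end

section \<open>Monotone paths and Poisson points\<close>

text \<open>A strictly monotone function preserves ranks: \<open>f v\<close> is the element of the
  range with the same rank as \<open>v\<close> in \<open>S\<close>.\<close>

lemma strict_mono_on_image_eq:
  fixes f g :: "nat \<Rightarrow> nat"
  assumes S: "finite S" and f: "strict_mono_on S f" and g: "strict_mono_on S g"
    and eq: "f ` S = g ` S" and v: "v \<in> S"
  shows "f v = g v"
proof -
  have rank: "card {x \<in> h ` S. x < h v} = card {w \<in> S. w < v}" if h: "strict_mono_on S h" for h :: "nat \<Rightarrow> nat"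
  proof -
    have "{x \<in> h ` S. x < h v} = h ` {w \<in> S. w < v}"
      using strict_mono_on_less[OF h _ v] by auto
    moreover have "inj_on h {w \<in> S. w < v}"
      using strict_mono_on_imp_inj_on[OF h] by (rule inj_on_subset) auto
    ultimately show ?thesis by (simp add: card_image)
  qed
  have lt: "card {x \<in> f ` S. x < a} < card {x \<in> f ` S. x < b}" if "a \<in> f ` S" "a < b" for a b
    by (rule psubset_card_mono) (use S that in auto)
  have "card {x \<in> f ` S. x < f v} = card {x \<in> f ` S. x < g v}"
    using rank[OF f] rank[OF g] eq by simp
  moreover have "f v \<in> f ` S" "g v \<in> f ` S" using v eq by auto
  ultimately show ?thesis using lt[of "f v" "g v"] lt[of "g v" "f v"] by (cases "f v" "g v" rule: linorder_cases) auto
qed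

text \<open>Adding to \<open>f v\<close> the rank of \<open>v\<close> in \<open>S\<close> turns monotone functions into strictly monotone ones, which are
  determined by their range.\<close>

lemma card_mono_funs:
  assumes S: "finite (S :: nat set)"
  shows "finite {f \<in> S \<rightarrow>\<^sub>E {..<n :: nat}. mono_on S f}"
    and "card {f \<in> S \<rightarrow>\<^sub>E {..<n :: nat}. mono_on S f} \<le> (n + card S) choose card S"
proof -
  let ?F = "{f \<in> S \<rightarrow>\<^sub>E {..<n}. mono_on S f}"
  let ?r = "\<lambda>v. card {w \<in> S. w < v}"
  let ?s = "\<lambda>f v. f v + ?r v"
  have r: "?r v < ?r w" if "v \<in> S" "v < w" for v w
    by (rule psubset_card_mono) (use S that in auto)
  have sm: "strict_mono_on S (?s f)" if "f \<in> ?F" for f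
    using that r by (auto simp: strict_mono_on_def mono_on_def intro!: add_le_less_mono)
  have rS: "?r v < card S" if "v \<in> S" for v
    by (rule psubset_card_mono) (use S that in auto)
  show "finite ?F" using S by (intro finite_subset[OF _ finite_PiE[of S "\<lambda>_. {..<n}"]]) auto
  have "card ?F \<le> card {B. B \<subseteq> {..<n + card S} \<and> card B = card S}"
  proof (rule card_inj_on_le[where f = "\<lambda>f. ?s f ` S"])
    show "inj_on (\<lambda>f. ?s f ` S) ?F"
    proof (rule inj_onI)
      fix f g assume fg: "f \<in> ?F" "g \<in> ?F" "?s f ` S = ?s g ` S"
      have "f v = g v" if "v \<in> S" for v
        using strict_mono_on_image_eq[OF S sm[OF fg(1)] sm[OF fg(2)] fg(3) that] by simp
      then show "f = g" using fg by (intro PiE_ext[of f S _ g]) auto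
    qed
    have "?s f ` S \<subseteq> {..<n + card S} \<and> card (?s f ` S) = card S" if f: "f \<in> ?F" for f
    proof
      show "card (?s f ` S) = card S" by (rule card_image[OF strict_mono_on_imp_inj_on[OF sm[OF f]]])
      show "?s f ` S \<subseteq> {..<n + card S}"
      proof (rule image_subsetI)
        fix v assume v: "v \<in> S"
        then have "f v < n" using f by auto
        then show "f v + card {w \<in> S. w < v} \<in> {..<n + card S}" using rS[OF v] by simp
      qed
    qed
    then show "(\<lambda>f. ?s f ` S) ` ?F \<subseteq> {B. B \<subseteq> {..<n + card S} \<and> card B = card S}" by blast
  qed (auto intro: finite_subset[of _ "Pow {..<n + card S}"])
  then show "card ?F \<le> (n + card S) choose card S" by (simp add: n_subsets)
qed

section \<open>Hitting probabilities and exponential moments of Poisson counts\<close>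

locale poisson_points =
  fixes M :: "'w measure" and N :: "'w \<Rightarrow> (real \<times> real \<times> real) measure"
  assumes poisson: "poisson_point_process M ambient N"
begin

sublocale prob_space M
  using poisson by (simp add: poisson_point_process_def)

lemma sets_N: "\<omega> \<in> space M \<Longrightarrow> sets (N \<omega>) = sets ambient"
  using poisson by (simp add: poisson_point_process_def)

lemma enat_N: "\<omega> \<in> space M \<Longrightarrow> A \<in> sets ambient \<Longrightarrow> emeasure (N \<omega>) A \<in> range ennreal_of_enat"
  using poisson by (simp add: poisson_point_process_def)

lemma meas_N [measurable]: "A \<in> sets ambient \<Longrightarrow> (\<lambda>\<omega>. emeasure (N \<omega>) A) \<in> borel_measurable M"
  using poisson by (simp add: poisson_point_process_def)

lemma poisson_N:
  assumes "A \<in> sets ambient" "emeasure ambient A < \<infinity>"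
  shows "prob {\<omega> \<in> space M. emeasure (N \<omega>) A = of_nat k}
    = measure ambient A ^ k / fact k * exp (- measure ambient A)"
  using poisson assms unfolding poisson_point_process_def by blast

lemma indep_N:
  assumes "finite I" "A ` I \<subseteq> sets ambient" "disjoint_family_on A I"
  shows "indep_vars (\<lambda>_. borel) (\<lambda>i \<omega>. emeasure (N \<omega>) (A i)) (I :: nat set)"
  using poisson assms unfolding poisson_point_process_def by blast

lemma hit_event [measurable]:
  assumes "A \<in> sets ambient"
  shows "{\<omega> \<in> space M. emeasure (N \<omega>) A \<noteq> 0} \<in> events"
proof -
  have "{\<omega> \<in> space M. emeasure (N \<omega>) A \<noteq> 0} = space M - {\<omega> \<in> space M. emeasure (N \<omega>) A = 0}"
    by auto
  moreover have "{\<omega> \<in> space M. emeasure (N \<omega>) A = 0} \<in> events" using assms by measurable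
  ultimately show ?thesis by auto
qed

lemma prob_hit_le:
  assumes "A \<in> sets ambient" "emeasure ambient A < \<infinity>"
  shows "prob {\<omega> \<in> space M. emeasure (N \<omega>) A \<noteq> 0} \<le> measure ambient A"
proof -
  have m: "{\<omega> \<in> space M. emeasure (N \<omega>) A = 0} \<in> events" using assms by measurable
  have "{\<omega> \<in> space M. emeasure (N \<omega>) A \<noteq> 0} = space M - {\<omega> \<in> space M. emeasure (N \<omega>) A = 0}"
    by auto
  then have "prob {\<omega> \<in> space M. emeasure (N \<omega>) A \<noteq> 0} = 1 - exp (- measure ambient A)"
    using prob_compl[OF m] poisson_N[OF assms, of 0] by simp
  then show ?thesis using exp_ge_add_one_self[of "- measure ambient A"] by simp
qed

text \<open>The Poisson probabilities of the finite values already sum to 1, so the value infinity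
  has probability 0.\<close>

lemma AE_nat:
  assumes "A \<in> sets ambient" "emeasure ambient A < \<infinity>"
  shows "AE \<omega> in M. \<exists>k::nat. emeasure (N \<omega>) A = of_nat k"
proof -
  let ?E = "\<lambda>k::nat. {\<omega> \<in> space M. emeasure (N \<omega>) A = of_nat k}"
  have m: "?E k \<in> events" for k using assms by measurable
  have "(\<lambda>k. prob (?E k)) sums prob (\<Union>k. ?E k)"
    by (rule finite_measure_UNION) (use m in \<open>auto simp: disjoint_family_on_def\<close>)
  moreover have "(\<lambda>k. prob (?E k)) sums 1"
  proof -
    have "(\<lambda>k. measure ambient A ^ k / fact k * exp (- measure ambient A))
        sums (exp (measure ambient A) * exp (- measure ambient A))"
      using exp_converges[of "measure ambient A"]
      by (intro sums_mult2) (simp add: scaleR_conv_of_real divide_inverse mult.commute)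
    then show ?thesis unfolding poisson_N[OF assms] by (simp flip: exp_add)
  qed
  ultimately have "prob (\<Union>k. ?E k) = 1" by (rule sums_unique2)
  then have "AE \<omega> in M. \<omega> \<in> (\<Union>k. ?E k)" using m by (intro AE_prob_1) auto
  then show ?thesis by eventually_elim auto
qed

lemma AE_finite_N:
  assumes "A \<in> sets ambient" "emeasure ambient A < \<infinity>"
  shows "AE \<omega> in M. emeasure (N \<omega>) A < \<infinity>"
  using AE_nat[OF assms] by eventually_elim (auto simp: of_nat_less_top)

text \<open>The expectation is split by the value of the count and summed as an exponential series.
  By \<open>AE_nat\<close> the default value of \<open>enn2real\<close> at infinity does not
  interfere.\<close>

lemma mgf_N:
  assumes "A \<in> sets ambient" "emeasure ambient A < \<infinity>"
  shows "(\<integral>\<^sup>+\<omega>. ennreal (exp (w * enn2real (emeasure (N \<omega>) A))) \<partial>M)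
    = ennreal (exp (measure ambient A * (exp w - 1)))"
proof -
  let ?E = "\<lambda>k::nat. {\<omega> \<in> space M. emeasure (N \<omega>) A = of_nat k}"
  let ?\<mu> = "measure ambient A"
  have m [measurable]: "?E k \<in> events" for k using assms by measurable
  have "(\<integral>\<^sup>+\<omega>. ennreal (exp (w * enn2real (emeasure (N \<omega>) A))) \<partial>M)
      = (\<integral>\<^sup>+\<omega>. (\<Sum>k. ennreal (exp (w * real k)) * indicator (?E k) \<omega>) \<partial>M)"
  proof (rule nn_integral_cong_AE)
    show "AE \<omega> in M. ennreal (exp (w * enn2real (emeasure (N \<omega>) A)))
        = (\<Sum>k. ennreal (exp (w * real k)) * indicator (?E k) \<omega>)"
      using AE_nat[OF assms] AE_space
    proof eventually_elim
      case (elim \<omega>)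
      then obtain k0 :: nat where k0: "emeasure (N \<omega>) A = of_nat k0" by auto
      have "(\<Sum>k. ennreal (exp (w * real k)) * indicator (?E k) \<omega>)
          = (\<Sum>k\<in>{k0}. ennreal (exp (w * real k)) * indicator (?E k) \<omega>)"
        by (rule suminf_finite) (auto simp: k0)
      then show ?case using elim(2) k0 by (simp add: ennreal_of_nat_eq_real_of_nat)
    qed
  qed
  also have "\<dots> = (\<Sum>k. ennreal (exp (w * real k)) * emeasure M (?E k))"
    by (subst nn_integral_suminf) (auto simp: nn_integral_cmult_indicator)
  also have "\<dots> = (\<Sum>k. ennreal (exp (- ?\<mu>) * ((?\<mu> * exp w) ^ k / fact k)))"
  proof (rule suminf_cong)
    fix k
    have "exp (w * real k) * (?\<mu> ^ k / fact k * exp (- ?\<mu>)) = exp (- ?\<mu>) * ((?\<mu> * exp w) ^ k / fact k)"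
      by (simp add: power_mult_distrib exp_of_nat_mult[symmetric] mult_ac)
    then show "ennreal (exp (w * real k)) * emeasure M (?E k) = ennreal (exp (- ?\<mu>) * ((?\<mu> * exp w) ^ k / fact k))"
      unfolding emeasure_eq_measure poisson_N[OF assms] by (simp add: ennreal_mult[symmetric])
  qed
  also have "\<dots> = ennreal (exp (- ?\<mu>) * exp (?\<mu> * exp w))"
  proof (rule suminf_ennreal_eq)
    show "(\<lambda>k. exp (- ?\<mu>) * ((?\<mu> * exp w) ^ k / fact k)) sums (exp (- ?\<mu>) * exp (?\<mu> * exp w))"
      using exp_converges[of "?\<mu> * exp w"]
      by (intro sums_mult) (simp add: scaleR_conv_of_real divide_inverse mult.commute)
  qed simp
  also have "exp (- ?\<mu>) * exp (?\<mu> * exp w) = exp (?\<mu> * (exp w - 1))"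
    by (simp add: exp_add[symmetric] algebra_simps)
  finally show ?thesis .
qed

text \<open>Counts of disjoint sets are independent, so the expectation factorises. Independence is
  given for indices in \<open>nat\<close>; pairs are transported there by
  \<open>prod_encode\<close>.\<close>

lemma mgf_sum:
  fixes A :: "nat \<times> nat \<Rightarrow> (real \<times> real \<times> real) set"
  assumes I: "finite I" and A: "\<And>i. i \<in> I \<Longrightarrow> A i \<in> sets ambient \<and> emeasure ambient (A i) < \<infinity>"
    and disj: "disjoint_family_on A I"
  shows "(\<integral>\<^sup>+\<omega>. ennreal (exp (\<Sum>i\<in>I. w i * enn2real (emeasure (N \<omega>) (A i)))) \<partial>M)
    = ennreal (exp (\<Sum>i\<in>I. measure ambient (A i) * (exp (w i) - 1)))"
proof -
  define J where "J = prod_encode ` I"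
  have J: "finite J" using I by (simp add: J_def)
  have reindex: "(\<Prod>n\<in>J. g (prod_decode n)) = (\<Prod>i\<in>I. g i)" for g :: "nat \<times> nat \<Rightarrow> ennreal"
    unfolding J_def by (subst prod.reindex) (auto simp: inj_on_def)
  define B where "B n = A (prod_decode n)" for n
  have indep: "indep_vars (\<lambda>_. borel) (\<lambda>n \<omega>. emeasure (N \<omega>) (B n)) J"
    by (rule indep_N[OF J]) (use A disj in \<open>auto simp: B_def J_def disjoint_family_on_def\<close>)
  have "(\<integral>\<^sup>+\<omega>. ennreal (exp (\<Sum>i\<in>I. w i * enn2real (emeasure (N \<omega>) (A i)))) \<partial>M)
      = (\<integral>\<^sup>+\<omega>. (\<Prod>n\<in>J. ennreal (exp (w (prod_decode n) * enn2real (emeasure (N \<omega>) (B n))))) \<partial>M)"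
    unfolding B_def by (subst reindex) (simp add: exp_sum[OF I] prod_ennreal)
  also have "\<dots> = (\<Prod>n\<in>J. \<integral>\<^sup>+\<omega>. ennreal (exp (w (prod_decode n) * enn2real (emeasure (N \<omega>) (B n)))) \<partial>M)"
    by (rule indep_vars_nn_integral[OF J indep_vars_compose2[OF indep]]) auto
  also have "\<dots> = (\<Prod>i\<in>I. \<integral>\<^sup>+\<omega>. ennreal (exp (w i * enn2real (emeasure (N \<omega>) (A i)))) \<partial>M)"
    unfolding B_def by (rule reindex)
  also have "\<dots> = (\<Prod>i\<in>I. ennreal (exp (measure ambient (A i) * (exp (w i) - 1))))"
    using A by (intro prod.cong mgf_N) auto
  also have "\<dots> = ennreal (exp (\<Sum>i\<in>I. measure ambient (A i) * (exp (w i) - 1)))"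
    by (simp add: exp_sum[OF I] prod_ennreal)
  finally show ?thesis .
qed

lemma prob_all_hit:
  assumes S: "finite (S :: nat set)" and A: "\<And>i. i \<in> S \<Longrightarrow> A i \<in> sets ambient \<and> emeasure ambient (A i) < \<infinity>"
    and disj: "disjoint_family_on A S" and q: "\<And>i. i \<in> S \<Longrightarrow> measure ambient (A i) \<le> q"
  shows "prob {\<omega> \<in> space M. \<forall>i\<in>S. emeasure (N \<omega>) (A i) \<noteq> 0} \<le> q ^ card S"
proof (cases "S = {}")
  case False
  have "indep_vars (\<lambda>_. borel) (\<lambda>i \<omega>. emeasure (N \<omega>) (A i)) S"
    by (rule indep_N) (use S A disj in auto)
  then have "prob (\<Inter>i\<in>S. (\<lambda>\<omega>. emeasure (N \<omega>) (A i)) -` (UNIV - {0}) \<inter> space M)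
      = (\<Prod>i\<in>S. prob ((\<lambda>\<omega>. emeasure (N \<omega>) (A i)) -` (UNIV - {0}) \<inter> space M))"
    by (rule indep_varsD_finite[OF _ False S]) auto
  also have "\<dots> \<le> (\<Prod>i\<in>S. q)"
  proof (rule prod_mono)
    fix i assume i: "i \<in> S"
    have "(\<lambda>\<omega>. emeasure (N \<omega>) (A i)) -` (UNIV - {0}) \<inter> space M = {\<omega> \<in> space M. emeasure (N \<omega>) (A i) \<noteq> 0}"
      by auto
    then show "0 \<le> prob ((\<lambda>\<omega>. emeasure (N \<omega>) (A i)) -` (UNIV - {0}) \<inter> space M) \<and>
        prob ((\<lambda>\<omega>. emeasure (N \<omega>) (A i)) -` (UNIV - {0}) \<inter> space M) \<le> q"
      using prob_hit_le[of "A i"] A[OF i] q[OF i] by auto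
  qed
  also have "(\<Inter>i\<in>S. (\<lambda>\<omega>. emeasure (N \<omega>) (A i)) -` (UNIV - {0}) \<inter> space M)
      = {\<omega> \<in> space M. \<forall>i\<in>S. emeasure (N \<omega>) (A i) \<noteq> 0}" using False by auto
  finally show ?thesis by simp
qed simp

end

lemma emeasure_slab:
  assumes "0 \<le> s" "s \<le> t" "0 \<le> w"
  shows "emeasure ambient (slab s t i w) = ennreal (2 * (t - s) * w)"
  unfolding slab_def using assms
  by (subst emeasure_ambient_box)
    (auto simp: emeasure_shell ennreal_mult[symmetric] simp flip: ennreal_numeral)

lemma measure_slab:
  assumes "0 \<le> s" "s \<le> t" "0 \<le> w"
  shows "measure ambient (slab s t i w) = 2 * (t - s) * w" "emeasure ambient (slab s t i w) < \<infinity>"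
  using emeasure_slab[OF assms] assms by (auto simp: measure_def)

lemma measure_cell:
  assumes "0 \<le> w" "D > 0"
  shows "measure ambient (cell D n i w) = 2 * w / real D" "emeasure ambient (cell D n i w) < \<infinity>"
proof -
  have "real n / real D \<le> real (Suc n) / real D" by (simp add: divide_right_mono)
  note * = measure_slab[OF _ this assms(1), of i]
  show "measure ambient (cell D n i w) = 2 * w / real D"
    unfolding cell_def using *(1) by (simp add: diff_divide_distrib[symmetric])
  show "emeasure ambient (cell D n i w) < \<infinity>" unfolding cell_def using *(2) by simp
qed

lemma cell_disjoint:
  assumes "D > 0" "(n, i) \<noteq> (n', i')"
  shows "cell D n i w \<inter> cell D n' i' w = {}"
proof (cases "i = i'")
  case False
  then show ?thesis using disjoint_shell[OF False] by (auto simp: cell_def slab_def)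
next
  case True
  have aux: "cell D n i w \<inter> cell D m i w = {}" if "n < m" for n m :: nat
  proof -
    have "real (Suc n) / real D \<le> real m / real D" using that by (intro divide_right_mono) auto
    then show ?thesis by (force simp: cell_def slab_def)
  qed
  show ?thesis using aux[of n n'] aux[of n' n] True assms(2) by (cases n n' rule: linorder_cases) auto
qed

section \<open>Union bounds over chains of points and over paths of the front\<close>

context poisson_points
begin

text \<open>The failure of hypothesis \<open>E2\<close> of \<open>front_less\<close> for one
  \<open>m\<close>.\<close>

definition chain_event :: "nat \<Rightarrow> nat \<Rightarrow> nat \<Rightarrow> nat \<Rightarrow> real \<Rightarrow> 'w set" where
  "chain_event D n l k w = {\<omega> \<in> space M. \<exists>S f. S \<subseteq> {..<l} \<and> card S = k \<and> mono_on S f \<and> f ` S \<subseteq> {..<n} \<and>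
     (\<forall>v\<in>S. emeasure (N \<omega>) (cell D (f v) v w) \<noteq> 0)}"

text \<open>Union bound over the landing shells \<open>S\<close> and the monotone time indices
  \<open>f\<close>, of which only the restriction to \<open>S\<close> matters. Cells in distinct
  shells are hit independently, each with probability at most \<open>2 * w / D\<close>.\<close>

lemma chain_event_prob:
  assumes D: "D > 0" and w: "0 \<le> w"
  shows "chain_event D n l k w \<in> events"
    and "prob (chain_event D n l k w) \<le> real (l choose k) * real ((n + k) choose k) * (2 * w / real D) ^ k"
proof -
  define SS where "SS = {S. S \<subseteq> {..<l} \<and> card S = k}"
  define FF where "FF S = {f \<in> S \<rightarrow>\<^sub>E {..<n}. mono_on S f}" for S :: "nat set"
  define E where "E p = {\<omega> \<in> space M. \<forall>v\<in>fst p. emeasure (N \<omega>) (cell D (snd p v) v w) \<noteq> 0}"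
    for p :: "nat set \<times> (nat \<Rightarrow> nat)"
  have fSS: "finite SS" unfolding SS_def by (rule finite_subset[of _ "Pow {..<l}"]) auto
  have fS: "finite S" if "S \<in> SS" for S using that finite_subset[of S "{..<l}"] by (auto simp: SS_def)
  have fFF: "finite (FF S)" if "S \<in> SS" for S using card_mono_funs(1)[OF fS[OF that]] by (simp add: FF_def)
  have mE: "E p \<in> events" if "p \<in> Sigma SS FF" for p
  proof -
    have "{\<omega> \<in> space M. emeasure (N \<omega>) (cell D (snd p v) v w) \<noteq> 0} \<in> events" for v
      by (rule hit_event) simp
    then show ?thesis unfolding E_def using fS that by (intro sets.sets_Collect_finite_All) auto
  qed
  have eq: "chain_event D n l k w = (\<Union>p\<in>Sigma SS FF. E p)"
  proof (rule set_eqI, rule iffI)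
    fix \<omega> assume "\<omega> \<in> chain_event D n l k w"
    then obtain S f where Sf: "\<omega> \<in> space M" "S \<subseteq> {..<l}" "card S = k" "mono_on S f" "f ` S \<subseteq> {..<n}"
      "\<forall>v\<in>S. emeasure (N \<omega>) (cell D (f v) v w) \<noteq> 0" by (auto simp: chain_event_def)
    then have "(S, restrict f S) \<in> Sigma SS FF" by (auto simp: SS_def FF_def mono_on_def)
    moreover have "\<omega> \<in> E (S, restrict f S)" using Sf by (simp add: E_def)
    ultimately show "\<omega> \<in> (\<Union>p\<in>Sigma SS FF. E p)" by blast
  next
    fix \<omega> assume "\<omega> \<in> (\<Union>p\<in>Sigma SS FF. E p)"
    then obtain S f where "S \<in> SS" "f \<in> FF S" "\<omega> \<in> E (S, f)" by auto
    then show "\<omega> \<in> chain_event D n l k w"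
      unfolding chain_event_def E_def SS_def FF_def
      by (intro CollectI conjI exI[of _ S] exI[of _ f]) auto
  qed
  have fin: "finite (Sigma SS FF)" using fSS fFF by auto
  show "chain_event D n l k w \<in> events" unfolding eq using fin mE by (intro sets.finite_UN) auto
  have "prob (chain_event D n l k w) \<le> (\<Sum>p\<in>Sigma SS FF. prob (E p))"
    unfolding eq by (rule finite_measure_subadditive_finite[OF fin]) (use mE in auto)
  also have "\<dots> \<le> (\<Sum>p\<in>Sigma SS FF. (2 * w / real D) ^ k)"
  proof (rule sum_mono)
    fix p assume p: "p \<in> Sigma SS FF"
    then obtain S f where Sf: "p = (S, f)" "S \<in> SS" by auto
    have "prob (E p) \<le> (2 * w / real D) ^ card S"
      unfolding E_def Sf fst_conv snd_conv
      by (rule prob_all_hit[OF fS[OF Sf(2)]])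
        (use measure_cell[OF w D] cell_disjoint[OF D] in \<open>auto simp: disjoint_family_on_def\<close>)
    then show "prob (E p) \<le> (2 * w / real D) ^ k" using Sf by (simp add: SS_def)
  qed
  also have "\<dots> = real (card (Sigma SS FF)) * (2 * w / real D) ^ k" by simp
  also have "\<dots> \<le> real ((l choose k) * ((n + k) choose k)) * (2 * w / real D) ^ k"
  proof (intro mult_right_mono)
    have "card (Sigma SS FF) = (\<Sum>S\<in>SS. card (FF S))" using fSS fFF by (intro card_SigmaI) auto
    also have "\<dots> \<le> (\<Sum>S\<in>SS. (n + k) choose k)"
    proof (rule sum_mono)
      fix S assume "S \<in> SS"
      then show "card (FF S) \<le> (n + k) choose k"
        using card_mono_funs(2)[OF fS, of S n] by (simp add: FF_def SS_def)
    qed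
    also have "\<dots> = (l choose k) * ((n + k) choose k)" by (simp add: SS_def n_subsets)
    finally show "real (card (Sigma SS FF)) \<le> real ((l choose k) * ((n + k) choose k))" by (simp only: of_nat_le_iff)
  qed (use w in auto)
  finally show "prob (chain_event D n l k w) \<le> real (l choose k) * real ((n + k) choose k) * (2 * w / real D) ^ k"
    by simp
qed

text \<open>In one time step, the shells up to the old front carry the weights
  \<open>tail \<alpha> e\<close> of distinct depths, bounded by the convergent series. Each shell
  newly passed carries \<open>tail \<alpha> 0\<close>, and the numbers of those telescope to at most
  \<open>L\<close>.\<close>

lemma weight_total:
  assumes alpha: "\<alpha> > 2" and j: "mono_on {..n} j" "j ` {..n} \<subseteq> {..L :: nat}"
  shows "(\<Sum>m<n. \<Sum>i\<le>j (Suc m). tail \<alpha> (j m - i))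
    \<le> real n * (\<Sum>d. real d powr (1 - \<alpha>)) + real L * tail \<alpha> 0"
proof -
  let ?z = "\<Sum>d. real d powr (1 - \<alpha>)"
  have step: "(\<Sum>i\<le>b. tail \<alpha> (a - i)) \<le> ?z + (real b - real a) * tail \<alpha> 0" if ab: "a \<le> b" for a b :: nat
  proof -
    have "{..b} = {..a} \<union> {a<..b}" using ab by auto
    then have "(\<Sum>i\<le>b. tail \<alpha> (a - i)) = (\<Sum>i\<le>a. tail \<alpha> (a - i)) + (\<Sum>i\<in>{a<..b}. tail \<alpha> (a - i))"
      by (simp only:) (rule sum.union_disjoint, auto)
    also have "(\<Sum>i\<le>a. tail \<alpha> (a - i)) = (\<Sum>e<Suc a. tail \<alpha> e)"
      using sum.nat_diff_reindex[of "tail \<alpha>" "Suc a"] by (simp add: lessThan_Suc_atMost)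
    also have "\<dots> \<le> ?z" by (rule sum_tail_le[OF alpha])
    also have "(\<Sum>i\<in>{a<..b}. tail \<alpha> (a - i)) \<le> (\<Sum>i\<in>{a<..b}. tail \<alpha> 0)"
      using alpha by (intro sum_mono tail_le) auto
    also have "\<dots> = (real b - real a) * tail \<alpha> 0" using ab by (simp add: of_nat_diff)
    finally show ?thesis by simp
  qed
  have "(\<Sum>m<n. \<Sum>i\<le>j (Suc m). tail \<alpha> (j m - i))
      \<le> (\<Sum>m<n. ?z + (real (j (Suc m)) - real (j m)) * tail \<alpha> 0)"
    using j by (intro sum_mono step) (auto simp: mono_on_def)
  also have "\<dots> = real n * ?z + (\<Sum>m<n. real (j (Suc m)) - real (j m)) * tail \<alpha> 0"
    by (simp add: sum.distrib sum_distrib_right)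
  also have "(\<Sum>m<n. real (j (Suc m)) - real (j m)) = real (j n) - real (j 0)"
    by (rule sum_lessThan_telescope)
  also have "(real (j n) - real (j 0)) * tail \<alpha> 0 \<le> real L * tail \<alpha> 0"
  proof (rule mult_right_mono)
    have "j n \<le> L" using j(2) by auto
    then show "real (j n) - real (j 0) \<le> real L" by simp
  qed (use tail_nonneg[of \<alpha> 0] alpha in auto)
  finally show ?thesis by simp
qed

text \<open>The double sum in hypothesis \<open>E3\<close> of \<open>front_less\<close>.\<close>

definition path_weight :: "'w \<Rightarrow> real \<Rightarrow> nat \<Rightarrow> nat \<Rightarrow> (nat \<Rightarrow> nat) \<Rightarrow> real" where
  "path_weight \<omega> \<alpha> D n j =
     (\<Sum>m<n. \<Sum>i\<le>j (Suc m). enn2real (emeasure (N \<omega>) (cell D m i 1)) * tail \<alpha> (j m - i))"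

lemma path_weight_measurable [measurable]: "(\<lambda>\<omega>. path_weight \<omega> \<alpha> D n j) \<in> borel_measurable M"
proof -
  have [measurable]: "(\<lambda>\<omega>. emeasure (N \<omega>) (cell D m i 1)) \<in> borel_measurable M" for m i
    by (rule meas_N) simp
  show ?thesis unfolding path_weight_def by measurable
qed

text \<open>Chernoff bound: the cells are disjoint with mean \<open>2 / D\<close> each, and
  \<open>weight_total\<close> bounds the sum of the weights uniformly over the paths.\<close>

lemma path_weight_prob:
  assumes alpha: "\<alpha> > 2" and D: "D > 0" and lam: "r \<ge> 0"
    and j: "mono_on {..n} j" "j ` {..n} \<subseteq> {..L :: nat}"
  shows "prob {\<omega> \<in> space M. s \<le> path_weight \<omega> \<alpha> D n j}
    \<le> exp (2 / real D * (r * exp (r * tail \<alpha> 0)) *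
        (real n * (\<Sum>d. real d powr (1 - \<alpha>)) + real L * tail \<alpha> 0) - r * s)"
proof -
  define I where "I = Sigma {..<n} (\<lambda>m. {..j (Suc m)})"
  define A where "A p = cell D (fst p) (snd p) 1" for p
  define t where "t p = tail \<alpha> (j (fst p) - snd p)" for p
  define K where "K = r * exp (r * tail \<alpha> 0)"
  define B where "B = real n * (\<Sum>d. real d powr (1 - \<alpha>)) + real L * tail \<alpha> 0"
  have I: "finite I" by (simp add: I_def)
  have A: "A p \<in> sets ambient" "measure ambient (A p) = 2 / real D" "emeasure ambient (A p) < \<infinity>" for p
    using measure_cell[of 1 D] D by (auto simp: A_def)
  have disj: "disjoint_family_on A I"
    unfolding disjoint_family_on_def A_def using cell_disjoint[OF D] by (auto simp: prod_eq_iff)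
  have pw: "path_weight \<omega> \<alpha> D n j = (\<Sum>p\<in>I. t p * enn2real (emeasure (N \<omega>) (A p)))" for \<omega>
    unfolding path_weight_def I_def A_def t_def by (subst sum.Sigma) (auto simp: case_prod_unfold mult.commute)
  have tot: "(\<Sum>p\<in>I. t p) \<le> B"
  proof -
    have "(\<Sum>p\<in>I. t p) = (\<Sum>m<n. \<Sum>i\<le>j (Suc m). tail \<alpha> (j m - i))"
      unfolding I_def t_def by (subst sum.Sigma) (auto simp: case_prod_unfold)
    then show ?thesis using weight_total[OF alpha j] by (simp add: B_def)
  qed
  have t0: "0 \<le> t p" "t p \<le> tail \<alpha> 0" for p
    using alpha tail_nonneg tail_le by (auto simp: t_def)
  have "(\<Sum>p\<in>I. measure ambient (A p) * (exp (r * t p) - 1)) \<le> (\<Sum>p\<in>I. 2 / real D * (K * t p))"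
  proof (rule sum_mono)
    fix p
    \<comment> \<open>This leads to \<open>exp x - 1 \<le> x * exp x\<close>; as the weights are at
      most \<open>tail \<alpha> 0\<close>, the exponent is bounded linearly in them.\<close>
    have "1 - r * t p \<le> exp (- (r * t p))" using exp_ge_add_one_self[of "- (r * t p)"] by simp
    then have "(1 - r * t p) * exp (r * t p) \<le> exp (- (r * t p)) * exp (r * t p)"
      by (intro mult_right_mono) auto
    then have "exp (r * t p) - 1 \<le> r * t p * exp (r * t p)"
      by (simp add: exp_minus algebra_simps)
    also have "\<dots> \<le> r * t p * exp (r * tail \<alpha> 0)"
      using lam t0[of p] by (intro mult_left_mono) (auto intro!: mult_left_mono)
    finally show "measure ambient (A p) * (exp (r * t p) - 1) \<le> 2 / real D * (K * t p)"
      unfolding A(2) by (intro mult_left_mono) (auto simp: K_def mult_ac)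
  qed
  also have "\<dots> = 2 / real D * K * (\<Sum>p\<in>I. t p)"
    unfolding sum_distrib_left by (simp add: mult.assoc)
  also have "\<dots> \<le> 2 / real D * K * B"
    using tot lam by (intro mult_left_mono) (auto simp: K_def)
  finally have expo: "(\<Sum>p\<in>I. measure ambient (A p) * (exp (r * t p) - 1)) \<le> 2 / real D * K * B" .
  have ev: "{\<omega> \<in> space M. s \<le> path_weight \<omega> \<alpha> D n j} \<in> events" by measurable
  have "emeasure M {\<omega> \<in> space M. s \<le> path_weight \<omega> \<alpha> D n j}
      = (\<integral>\<^sup>+\<omega>. indicator {\<omega> \<in> space M. s \<le> path_weight \<omega> \<alpha> D n j} \<omega> \<partial>M)"
    using ev by simp
  also have "\<dots> \<le> (\<integral>\<^sup>+\<omega>. ennreal (exp (- (r * s))) * ennreal (exp (r * path_weight \<omega> \<alpha> D n j)) \<partial>M)"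
  proof (rule nn_integral_mono)
    fix \<omega>
    have "s \<le> path_weight \<omega> \<alpha> D n j \<Longrightarrow> r * s \<le> r * path_weight \<omega> \<alpha> D n j"
      using lam by (intro mult_left_mono)
    then show "indicator {\<omega> \<in> space M. s \<le> path_weight \<omega> \<alpha> D n j} \<omega>
        \<le> ennreal (exp (- (r * s))) * ennreal (exp (r * path_weight \<omega> \<alpha> D n j))"
      by (auto simp: ennreal_mult[symmetric] exp_add[symmetric] split: split_indicator)
  qed
  also have "\<dots> = ennreal (exp (- (r * s))) * (\<integral>\<^sup>+\<omega>. ennreal (exp (r * path_weight \<omega> \<alpha> D n j)) \<partial>M)"
    by (rule nn_integral_cmult) measurable
  also have "(\<integral>\<^sup>+\<omega>. ennreal (exp (r * path_weight \<omega> \<alpha> D n j)) \<partial>M)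
      = (\<integral>\<^sup>+\<omega>. ennreal (exp (\<Sum>p\<in>I. (r * t p) * enn2real (emeasure (N \<omega>) (A p)))) \<partial>M)"
    by (simp add: pw sum_distrib_left mult_ac)
  also have "\<dots> = ennreal (exp (\<Sum>p\<in>I. measure ambient (A p) * (exp (r * t p) - 1)))"
    using A by (intro mgf_sum I disj) auto
  also have "ennreal (exp (- (r * s))) * \<dots>
      = ennreal (exp ((\<Sum>p\<in>I. measure ambient (A p) * (exp (r * t p) - 1)) - r * s))"
    by (simp add: ennreal_mult[symmetric] exp_add[symmetric])
  also have "\<dots> \<le> ennreal (exp (2 / real D * K * B - r * s))"
    using expo by (intro ennreal_leI) auto
  finally show ?thesis
    unfolding emeasure_eq_measure K_def B_def by (subst (asm) ennreal_le_iff) auto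
qed

definition path_event :: "real \<Rightarrow> nat \<Rightarrow> nat \<Rightarrow> nat \<Rightarrow> real \<Rightarrow> 'w set" where
  "path_event \<alpha> D n L s = {\<omega> \<in> space M. \<exists>j. mono_on {..n} j \<and> j ` {..n} \<subseteq> {..L} \<and> s \<le> path_weight \<omega> \<alpha> D n j}"

lemma path_weight_cong:
  "(\<And>m. m \<le> n \<Longrightarrow> j m = j' m) \<Longrightarrow> path_weight \<omega> \<alpha> D n j = path_weight \<omega> \<alpha> D n j'"
  unfolding path_weight_def by (intro sum.cong refl) auto

text \<open>Union bound: restricted to \<open>{..n}\<close>, the monotone paths are counted by a
  binomial coefficient, which is at most \<open>2 ^ (n + L + 2)\<close>.\<close>

lemma path_event_prob:
  assumes alpha: "\<alpha> > 2" and D: "D > 0" and lam: "r \<ge> 0"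
  shows "path_event \<alpha> D n L s \<in> events"
    and "prob (path_event \<alpha> D n L s) \<le> 2 ^ (n + L + 2) *
      exp (2 / real D * (r * exp (r * tail \<alpha> 0)) *
        (real n * (\<Sum>d. real d powr (1 - \<alpha>)) + real L * tail \<alpha> 0) - r * s)"
    (is "_ \<le> _ * ?b")
proof -
  define F where "F = {f \<in> {..n} \<rightarrow>\<^sub>E {..<Suc L}. mono_on {..n} f}"
  have F: "finite F" "card F \<le> 2 ^ (n + L + 2)"
  proof -
    show "finite F" unfolding F_def by (rule card_mono_funs) simp
    have "card F \<le> (Suc L + Suc n) choose (Suc n)"
      using card_mono_funs(2)[of "{..n}" "Suc L"] by (simp add: F_def)
    also have "\<dots> \<le> 2 ^ (Suc L + Suc n)" by (rule binomial_le_pow2)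
    finally show "card F \<le> 2 ^ (n + L + 2)" by (simp add: add_ac)
  qed
  define E where "E j = {\<omega> \<in> space M. s \<le> path_weight \<omega> \<alpha> D n j}" for j
  have E: "E j \<in> events" for j unfolding E_def by measurable
  have eq: "path_event \<alpha> D n L s = (\<Union>j\<in>F. E j)"
  proof (rule set_eqI, rule iffI)
    fix \<omega> assume "\<omega> \<in> path_event \<alpha> D n L s"
    then obtain j where j: "\<omega> \<in> space M" "mono_on {..n} j" "j ` {..n} \<subseteq> {..L}" "s \<le> path_weight \<omega> \<alpha> D n j"
      by (auto simp: path_event_def)
    have "restrict j {..n} \<in> F" using j by (auto simp: F_def mono_on_def less_Suc_eq_le)
    moreover have "path_weight \<omega> \<alpha> D n j = path_weight \<omega> \<alpha> D n (restrict j {..n})"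
      by (rule path_weight_cong) simp
    then have "\<omega> \<in> E (restrict j {..n})" using j by (simp add: E_def)
    ultimately show "\<omega> \<in> (\<Union>j\<in>F. E j)" by blast
  next
    fix \<omega> assume "\<omega> \<in> (\<Union>j\<in>F. E j)"
    then obtain j where "j \<in> F" "\<omega> \<in> E j" by auto
    then show "\<omega> \<in> path_event \<alpha> D n L s"
      unfolding path_event_def E_def F_def
      by (intro CollectI conjI exI[of _ j]) (auto simp: less_Suc_eq_le PiE_iff)
  qed
  show "path_event \<alpha> D n L s \<in> events" unfolding eq using F E by (intro sets.finite_UN) auto
  have "prob (path_event \<alpha> D n L s) \<le> (\<Sum>j\<in>F. prob (E j))"
    unfolding eq by (rule finite_measure_subadditive_finite[OF F(1)]) (use E in auto)
  also have "\<dots> \<le> (\<Sum>j\<in>F. ?b)"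
  proof (rule sum_mono)
    fix j assume "j \<in> F"
    then show "prob (E j) \<le> ?b" unfolding E_def F_def
      by (intro path_weight_prob alpha D lam) (auto simp: less_Suc_eq_le PiE_iff)
  qed
  also have "\<dots> = real (card F) * ?b" by simp
  also have "\<dots> \<le> 2 ^ (n + L + 2) * ?b"
    using F(2)[THEN of_nat_mono[where 'a = real]] by (intro mult_right_mono) auto
  finally show "prob (path_event \<alpha> D n L s) \<le> 2 ^ (n + L + 2) * ?b" .
qed

end

section \<open>Scales\<close>

lemma power_le_exp_fact: "real k ^ k \<le> exp (real k) * fact k"
proof -
  have "(\<Sum>n\<in>{k}. real k ^ n /\<^sub>R fact n) \<le> (\<Sum>n. real k ^ n /\<^sub>R fact n)"
    by (rule sum_le_suminf[OF summable_exp_generic]) auto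
  then have "real k ^ k / fact k \<le> exp (real k)"
    by (simp add: exp_def scaleR_conv_of_real divide_inverse mult.commute)
  then show ?thesis by (simp add: divide_le_eq)
qed

text \<open>Combines the bound by \<open>n ^ k / fact k\<close> with
  \<open>fact k \<ge> (k / exp 1) ^ k\<close>, which comes from a single term of the exponential
  series.\<close>

lemma binomial_le_exp:
  assumes "k > 0"
  shows "real (n choose k) \<le> (exp 1 * real n / real k) ^ k"
proof -
  have "real (n choose k) * fact k \<le> real n ^ k"
    using binomial_fact_pow[of n k] by (metis of_nat_fact of_nat_le_iff of_nat_mult of_nat_power)
  then have "real (n choose k) * fact k * exp (real k) \<le> real n ^ k * exp (real k)"
    by (rule mult_right_mono) simp
  moreover have "real (n choose k) * real k ^ k \<le> real (n choose k) * (exp (real k) * fact k)"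
    using power_le_exp_fact[of k] by (rule mult_left_mono) simp
  moreover have "exp (real k) = exp 1 ^ k" using exp_of_nat_mult[of k "1 :: real"] by simp
  ultimately have "real (n choose k) * real k ^ k \<le> (exp 1 * real n) ^ k"
    unfolding power_mult_distrib by (metis (no_types, lifting) mult.assoc mult.commute order_trans)
  then show ?thesis using assms by (simp add: power_divide le_divide_eq)
qed

lemma inverse_power_two_le:
  assumes "k > 0"
  shows "(1 / 2 :: real) ^ k \<le> 1 / real k"
proof -
  have "real k \<le> 2 ^ k" using less_exp[of k] by (metis less_imp_le of_nat_less_numeral_power_cancel_iff)
  then have "1 / 2 ^ k \<le> 1 / real k" using assms by (intro divide_left_mono) auto
  then show ?thesis by (simp add: power_one_over)
qed

text \<open>The factor \<open>16 * c1\<close> is the parameter of the exponential moment in \<open>paths_prob\<close>, and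
  \<open>8 / (1 - 2 powr -\<delta>)\<close> is the inverse of the constant \<open>\<kappa>\<close> in the admissible number \<open>k p m\<close> of good jumps of
  length about \<open>2\<^sup>m\<close>.\<close>

locale constants =
  fixes \<alpha> c1 \<beta> :: real and D C :: nat
  assumes alpha: "\<alpha> > 2" and c1: "c1 > 0"
    and beta: "2 / \<alpha> < \<beta>" "\<beta> < 4 / (\<alpha> + 2)"
    and D_large: "D > 0"
      "16 * exp 2 * 8 / (1 - 2 powr (- (\<alpha> - 2) / 4)) \<le> real D"
      "2 * (16 * c1 * exp (16 * c1 * tail \<alpha> 0)) * tail \<alpha> 0 \<le> real D"
    and C_large: "2 \<le> C" "16 * exp 2 * (8 / (1 - 2 powr (- (\<alpha> - 2) / 4)))\<^sup>2 \<le> real C"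
      "2 * c1 * tail \<alpha> 0 \<le> real C"
      "real D + 2 + 2 * (16 * c1 * exp (16 * c1 * tail \<alpha> 0)) * (\<Sum>d. real d powr (1 - \<alpha>)) \<le> real C"
begin

text \<open>Chosen so that \<open>1 < 1 + \<delta> \<le> \<alpha> / 2\<close>: the lower bound makes
  the total length of good jumps summable over dyadic sizes, the upper one keeps
  \<open>k p m\<close> above the typical length of a chain.\<close>

definition \<delta> where "\<delta> = (\<alpha> - 2) / 4"
definition \<kappa> where "\<kappa> = (1 - 2 powr -\<delta>) / 8"
definition L :: "nat \<Rightarrow> nat" where "L p = C * 2 ^ p"
text \<open>The cutoff \<open>2 ^ M p\<close> is of order \<open>T powr \<beta>\<close> for
  \<open>T = 2 ^ p\<close>: large enough that longer good jumps are rare, small enough that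
  \<open>k p m\<close> still grows for every \<open>m \<le> M p\<close>.\<close>

definition M :: "nat \<Rightarrow> nat" where "M p = nat \<lfloor>\<beta> * real p\<rfloor>"
text \<open>The added 1 makes \<open>k\<close> positive and at least the real number inside the
  floor, while \<open>k - 1\<close>, the number of jumps tolerated, does not exceed it.\<close>

definition k :: "nat \<Rightarrow> nat \<Rightarrow> nat" where "k p m = nat \<lfloor>\<kappa> * real (L p) * (2 ^ m) powr -(1 + \<delta>)\<rfloor> + 1"
definition s :: "nat \<Rightarrow> real" where "s p = real (L p) / (4 * c1)"

lemma delta_pos: "0 < \<delta>"
  using alpha by (simp add: \<delta>_def)

lemma alpha_delta: "2 * (1 + \<delta>) \<le> \<alpha>" "1 + \<delta> = (\<alpha> + 2) / 4"
  using alpha by (auto simp: \<delta>_def field_simps)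

lemma two_powr_less: "2 powr -\<delta> < (1 :: real)"
  using delta_pos powr_less_mono[of "-\<delta>" 0 2] by simp

lemma kappa_pos: "0 < \<kappa>"
  using two_powr_less by (simp add: \<kappa>_def)

text \<open>The last three bounds are the exponents needed for long jumps landing within
  \<open>L p\<close>, for chains, and for long jumps landing beyond \<open>L p\<close>.\<close>

lemma beta_bounds: "0 < \<beta>" "\<beta> < 1" "2 < \<alpha> * \<beta>" "\<beta> * (1 + \<delta>) < 1" "1 < \<beta> * (\<alpha> - 1 - \<delta>)"
proof -
  have "0 < 2 / \<alpha>" using alpha by simp
  then show b0: "0 < \<beta>" using beta by linarith
  have "4 / (\<alpha> + 2) < 1" using alpha by simp
  then show "\<beta> < 1" using beta by linarith
  show ab: "2 < \<alpha> * \<beta>" using beta(1) alpha by (simp add: divide_less_eq mult.commute)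
  show "\<beta> * (1 + \<delta>) < 1" unfolding alpha_delta(2) using beta(2) alpha by (simp add: less_divide_eq)
  have "\<beta> * (\<alpha> / 2) \<le> \<beta> * (\<alpha> - 1 - \<delta>)"
    using b0 alpha by (intro mult_left_mono) (auto simp: \<delta>_def field_simps)
  then show "1 < \<beta> * (\<alpha> - 1 - \<delta>)" using ab by (simp add: mult.commute)
qed

lemma L_pos: "0 < L p" "real (L p) = real C * 2 ^ p" "2 ^ p \<le> real (L p)"
proof -
  show "0 < L p" using C_large(1) by (simp add: L_def)
  show eq: "real (L p) = real C * 2 ^ p" by (simp add: L_def)
  show "2 ^ p \<le> real (L p)" unfolding eq using C_large(1) by simp
qed

lemma M_bounds: "2 ^ Suc (M p) \<le> L p" "2 powr (\<beta> * real p) \<le> 2 ^ Suc (M p)"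
  "m \<le> M p \<Longrightarrow> 2 ^ m \<le> 2 powr (\<beta> * real p)" "M p \<le> p"
proof -
  have bp: "0 \<le> \<beta> * real p" using beta_bounds by simp
  have Mr: "real (M p) = of_int \<lfloor>\<beta> * real p\<rfloor>" using bp by (simp add: M_def)
  have "\<beta> * real p \<le> real p" using beta_bounds by (intro mult_left_le_one_le) auto
  moreover have "real (M p) \<le> \<beta> * real p" unfolding Mr by linarith
  ultimately show Mp: "M p \<le> p" by linarith
  have "(2 :: nat) ^ Suc (M p) \<le> 2 * 2 ^ p" using Mp by (simp add: power_increasing)
  also have "\<dots> \<le> L p" using C_large(1) by (simp add: L_def)
  finally show "2 ^ Suc (M p) \<le> L p" .
  have "\<beta> * real p \<le> real (Suc (M p))" using Mr by simp linarith
  then have "2 powr (\<beta> * real p) \<le> 2 powr real (Suc (M p))" by (intro powr_mono) auto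
  then show "2 powr (\<beta> * real p) \<le> 2 ^ Suc (M p)" by (simp only: powr_realpow zero_less_numeral)
  show "2 ^ m \<le> 2 powr (\<beta> * real p)" if "m \<le> M p"
  proof -
    have "real m \<le> \<beta> * real p" using that \<open>real (M p) \<le> \<beta> * real p\<close> by simp
    then have "2 powr real m \<le> 2 powr (\<beta> * real p)" by (intro powr_mono) auto
    then show ?thesis by (simp add: powr_realpow)
  qed
qed

lemma k_bounds: "0 < k p m" "real (k p m - 1) \<le> \<kappa> * real (L p) * (2 ^ m) powr -(1 + \<delta>)"
  "\<kappa> * real (L p) * (2 ^ m) powr -(1 + \<delta>) \<le> real (k p m)"
proof -
  have "0 \<le> \<kappa> * real (L p) * (2 ^ m) powr -(1 + \<delta>)" using kappa_pos by simp
  then show "0 < k p m" "real (k p m - 1) \<le> \<kappa> * real (L p) * (2 ^ m) powr -(1 + \<delta>)"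
    "\<kappa> * real (L p) * (2 ^ m) powr -(1 + \<delta>) \<le> real (k p m)"
    unfolding k_def by (simp_all; linarith)+
qed

text \<open>The budget \<open>L p\<close> is split: a quarter for the good jumps, by the geometric
  series and the choice of \<open>\<kappa>\<close>; half for the initial particle; a quarter for the
  other sources, by the choice of \<open>s\<close>.\<close>

lemma total_bound:
  "(\<Sum>m\<le>M p. 2 ^ Suc m * real (k p m - 1)) + c1 * (tail \<alpha> 0 + s p) \<le> real (L p)"
proof -
  let ?x = "2 powr -\<delta> :: real"
  have "(\<Sum>m\<le>M p. 2 ^ Suc m * real (k p m - 1)) \<le> (\<Sum>m\<le>M p. 2 * \<kappa> * real (L p) * ?x ^ m)"
  proof (rule sum_mono)
    fix m
    have "2 ^ Suc m * real (k p m - 1) \<le> 2 ^ Suc m * (\<kappa> * real (L p) * (2 ^ m) powr -(1 + \<delta>))"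
      using k_bounds(2) by (intro mult_left_mono) auto
    also have "\<dots> = 2 * \<kappa> * real (L p) * (2 ^ m * (2 ^ m) powr -(1 + \<delta>))" by simp
    also have "(2 :: real) ^ m * (2 ^ m) powr -(1 + \<delta>) = (2 ^ m) powr (1 + -(1 + \<delta>))"
      by (subst powr_add) simp
    also have "\<dots> = ?x ^ m" by (simp add: powr_power[symmetric] powr_powr flip: powr_realpow) (simp add: mult.commute)
    finally show "2 ^ Suc m * real (k p m - 1) \<le> 2 * \<kappa> * real (L p) * ?x ^ m" .
  qed
  also have "\<dots> = 2 * \<kappa> * real (L p) * (\<Sum>m\<le>M p. ?x ^ m)" by (simp add: sum_distrib_left)
  also have "\<dots> \<le> 2 * \<kappa> * real (L p) * (1 / (1 - ?x))"
  proof (rule mult_left_mono)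
    have "(\<Sum>m\<le>M p. ?x ^ m) \<le> (\<Sum>m. ?x ^ m)"
      using two_powr_less by (intro sum_le_suminf summable_geometric) auto
    then show "(\<Sum>m\<le>M p. ?x ^ m) \<le> 1 / (1 - ?x)" using two_powr_less by (simp add: suminf_geometric)
  qed (use kappa_pos in simp)
  also have "\<dots> = real (L p) / 4"
  proof -
    have "2 * (y / 8) * l * (1 / y) = l / 4" if "y > 0" for y l :: real using that by simp
    then show ?thesis unfolding \<kappa>_def using two_powr_less by (metis diff_gt_0_iff_gt)
  qed
  finally have 1: "(\<Sum>m\<le>M p. 2 ^ Suc m * real (k p m - 1)) \<le> real (L p) / 4" .
  have "real C * 1 \<le> real (L p)" unfolding L_pos by (intro mult_left_mono) auto
  then have "2 * (c1 * tail \<alpha> 0) \<le> real (L p)" using C_large(3) by simp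
  moreover have "c1 * s p = real (L p) / 4" using c1 by (simp add: s_def)
  ultimately show ?thesis using 1 by (simp add: distrib_left)
qed

end

section \<open>Probabilities of the exceptional events at time \<open>2 ^ p\<close>\<close>

locale scales = constants + P: poisson_points M' N for M' :: "'w measure" and N
begin

definition big_event :: "nat \<Rightarrow> 'w set" where
  "big_event p = {\<omega> \<in> space M'. \<exists>v. emeasure (N \<omega>)
     (slab 0 (2 ^ p) v (max (2 ^ Suc (M p)) (real (v - L p)) powr -\<alpha>)) \<noteq> 0}"

text \<open>Union bound over all shells. Those up to \<open>L p\<close> share one mark bound;
  beyond, the decreasing mark bounds make the series converge.\<close>

lemma big_event_prob:
  "big_event p \<in> P.events"
  "P.prob (big_event p) \<le> 4 * (C + 1) * (2 powr (2 - \<alpha> * \<beta>)) ^ p +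
     2 * (\<Sum>d. real d powr -(1 + \<delta>)) * (2 powr (1 - \<beta> * (\<alpha> - 1 - \<delta>))) ^ p"
proof -
  define \<rho> where "\<rho> = (2 :: real) ^ Suc (M p)"
  define w where "w v = max \<rho> (real (v - L p)) powr -\<alpha>" for v
  define E where "E v = {\<omega> \<in> space M'. emeasure (N \<omega>) (slab 0 (2 ^ p) v (w v)) \<noteq> 0}" for v
  define g where "g v = (if v \<in> {..L p} then \<rho> powr -\<alpha> else 0) + \<rho> powr -(\<alpha> - 1 - \<delta>) * real (v - L p) powr -(1 + \<delta>)" for v
  define Z where "Z = (\<Sum>d. real d powr -(1 + \<delta>))"
  have rho: "1 \<le> \<rho>" unfolding \<rho>_def by (rule one_le_power) simp
  have w0: "0 \<le> w v" for v by (simp add: w_def)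
  have E: "E v \<in> P.events" for v unfolding E_def by (rule P.hit_event) (auto intro: slab_sets)
  have eq: "big_event p = (\<Union>v. E v)" by (auto simp: big_event_def E_def w_def \<rho>_def)
  show "big_event p \<in> P.events" unfolding eq using E by auto
  have PE: "P.prob (E v) \<le> 2 * 2 ^ p * w v" for v
    unfolding E_def using P.prob_hit_le[of "slab 0 (2 ^ p) v (w v)"] measure_slab[of 0 "2 ^ p" "w v" v] w0[of v]
    by (auto simp: slab_sets)
  have wg: "w v \<le> g v" for v
  proof (cases "v \<le> L p")
    case True
    then show ?thesis using rho by (simp add: w_def g_def)
  next
    case False
    define d where "d = real (v - L p)"
    have d: "1 \<le> d" using False by (simp add: d_def)
    \<comment> \<open>The exponent is split: one part gives a negative power of the cutoff, the
      other remains summable over the distance beyond \<open>L p\<close>.\<close>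
    have "w v = max \<rho> d powr (-(\<alpha> - 1 - \<delta>) + -(1 + \<delta>))" by (simp add: w_def d_def)
    also have "\<dots> = max \<rho> d powr -(\<alpha> - 1 - \<delta>) * max \<rho> d powr -(1 + \<delta>)" by (rule powr_add)
    also have "\<dots> \<le> \<rho> powr -(\<alpha> - 1 - \<delta>) * d powr -(1 + \<delta>)"
      using rho d alpha delta_pos alpha_delta(1) by (intro mult_mono powr_mono2') auto
    finally show ?thesis using False by (simp add: g_def d_def)
  qed
  have sumZ: "summable (\<lambda>d. real d powr -(1 + \<delta>))" using delta_pos by (simp add: summable_real_powr_iff)
  have "(\<lambda>v. real (v - L p) powr -(1 + \<delta>)) sums Z"
  proof -
    have "(\<lambda>v. real (v + L p - L p) powr -(1 + \<delta>)) sums (Z - 0)" using sumZ by (simp add: Z_def summable_sums)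
    moreover have "(\<Sum>v<L p. real (v - L p) powr -(1 + \<delta>)) = 0" by (intro sum.neutral) auto
    ultimately show ?thesis
      using sums_iff_shift[of "\<lambda>v. real (v - L p) powr -(1 + \<delta>)" "L p" Z] by simp
  qed
  then have "g sums ((\<Sum>v\<in>{..L p}. \<rho> powr -\<alpha>) + \<rho> powr -(\<alpha> - 1 - \<delta>) * Z)"
    unfolding g_def by (intro sums_add sums_mult sums_If_finite_set) auto
  then have g: "summable g" "suminf g = (real (L p) + 1) * \<rho> powr -\<alpha> + \<rho> powr -(\<alpha> - 1 - \<delta>) * Z"
    by (auto simp: sums_iff add.commute)
  have sg: "summable (\<lambda>v. 2 * 2 ^ p * g v)" using g(1) by (rule summable_mult)
  have PEg: "P.prob (E v) \<le> 2 * 2 ^ p * g v" for v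
    by (rule order_trans[OF PE mult_left_mono[OF wg]]) simp
  have sE: "summable (\<lambda>v. P.prob (E v))"
    by (rule summable_comparison_test'[OF sg, of 0]) (use PEg in auto)
  have "P.prob (big_event p) \<le> (\<Sum>v. P.prob (E v))"
    unfolding eq by (rule P.finite_measure_subadditive_countably) (use E sE in auto)
  also have "\<dots> \<le> (\<Sum>v. 2 * 2 ^ p * g v)" by (rule suminf_le[OF PEg sE sg])
  also have "\<dots> = 2 * 2 ^ p * ((real (L p) + 1) * \<rho> powr -\<alpha> + \<rho> powr -(\<alpha> - 1 - \<delta>) * Z)"
    using g by (simp add: suminf_mult)
  also have "\<dots> \<le> 2 * 2 ^ p * ((real C + 1) * 2 ^ p * 2 powr -(\<alpha> * \<beta> * real p) + 2 powr -(\<beta> * (\<alpha> - 1 - \<delta>) * real p) * Z)"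
  proof (intro mult_left_mono add_mono mult_mono mult_right_mono)
    have r: "2 powr (\<beta> * real p) \<le> \<rho>" using M_bounds(2) by (simp add: \<rho>_def)
    have "\<rho> powr -\<alpha> \<le> (2 powr (\<beta> * real p)) powr -\<alpha>"
      using r alpha by (intro powr_mono2') auto
    then show "\<rho> powr -\<alpha> \<le> 2 powr -(\<alpha> * \<beta> * real p)" by (simp add: powr_powr mult_ac)
    have "\<rho> powr -(\<alpha> - 1 - \<delta>) \<le> (2 powr (\<beta> * real p)) powr -(\<alpha> - 1 - \<delta>)"
      using r alpha alpha_delta(1) delta_pos by (intro powr_mono2') auto
    also have "\<dots> = 2 powr ((\<beta> * real p) * -(\<alpha> - 1 - \<delta>))" by (rule powr_powr)
    also have "(\<beta> * real p) * -(\<alpha> - 1 - \<delta>) = -(\<beta> * (\<alpha> - 1 - \<delta>) * real p)" by (simp add: algebra_simps)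
    finally show "\<rho> powr -(\<alpha> - 1 - \<delta>) \<le> 2 powr -(\<beta> * (\<alpha> - 1 - \<delta>) * real p)" .
    show "real (L p) + 1 \<le> (real C + 1) * 2 ^ p" by (simp add: L_pos(2) distrib_right)
    show "0 \<le> Z" unfolding Z_def by (intro suminf_nonneg sumZ) auto
  qed auto
  also have "\<dots> = 2 * (C + 1) * (2 ^ p * 2 ^ p * 2 powr -(\<alpha> * \<beta> * real p))
      + 2 * Z * (2 ^ p * 2 powr -(\<beta> * (\<alpha> - 1 - \<delta>) * real p))"
    by (simp add: algebra_simps)
  also have "2 ^ p * 2 ^ p * 2 powr -(\<alpha> * \<beta> * real p) = (2 powr (2 - \<alpha> * \<beta>)) ^ p"
  proof -
    have "(2 :: real) ^ p * 2 ^ p * 2 powr -(\<alpha> * \<beta> * real p) = 2 powr (real p + real p + -(\<alpha> * \<beta> * real p))"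
      by (simp only: powr_add powr_realpow zero_less_numeral)
    also have "\<dots> = 2 powr ((2 - \<alpha> * \<beta>) * real p)" by (simp add: algebra_simps)
    also have "\<dots> = (2 powr (2 - \<alpha> * \<beta>)) ^ p" by (simp add: powr_powr[symmetric] powr_realpow)
    finally show ?thesis .
  qed
  also have "2 ^ p * 2 powr -(\<beta> * (\<alpha> - 1 - \<delta>) * real p) = (2 powr (1 - \<beta> * (\<alpha> - 1 - \<delta>))) ^ p"
  proof -
    have "(2 :: real) ^ p * 2 powr -(\<beta> * (\<alpha> - 1 - \<delta>) * real p) = 2 powr (real p + -(\<beta> * (\<alpha> - 1 - \<delta>) * real p))"
      by (simp only: powr_add powr_realpow zero_less_numeral)
    also have "\<dots> = 2 powr ((1 - \<beta> * (\<alpha> - 1 - \<delta>)) * real p)" by (simp add: algebra_simps)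
    also have "\<dots> = (2 powr (1 - \<beta> * (\<alpha> - 1 - \<delta>))) ^ p" by (simp add: powr_powr[symmetric] powr_realpow)
    finally show ?thesis .
  qed
  finally show "P.prob (big_event p) \<le> 4 * (C + 1) * (2 powr (2 - \<alpha> * \<beta>)) ^ p +
     2 * (\<Sum>d. real d powr -(1 + \<delta>)) * (2 powr (1 - \<beta> * (\<alpha> - 1 - \<delta>))) ^ p"
    unfolding Z_def by (rule order_trans) (auto intro!: mult_right_mono)
qed

abbreviation chains :: "nat \<Rightarrow> nat \<Rightarrow> 'w set" where
  "chains p m \<equiv> P.chain_event D (2 ^ p * D) (2 * L p) (k p m) ((2 ^ m) powr -\<alpha>)"

text \<open>With \<open>binomial_le_exp\<close> the union bound becomes the \<open>q\<close>-th
  power of an expression that the choice of \<open>C\<close> and \<open>D\<close> makes at most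
  \<open>1 / 2\<close>.\<close>

lemma chains_prob:
  assumes m: "m \<le> M p"
  shows "P.prob (chains p m) \<le> 1 / (\<kappa> * C) * (2 powr (\<beta> * (1 + \<delta>) - 1)) ^ p"
proof -
  define x where "x = ((2 :: real) ^ m) powr -(1 + \<delta>)"
  define w where "w = ((2 :: real) ^ m) powr -\<alpha>"
  define q where "q = k p m"
  have pos: "0 < x" "0 < w" "0 < real q" "0 < q" "0 < real D" "0 < real (L p)"
    using k_bounds(1) D_large(1) L_pos(1) by (auto simp: x_def w_def q_def)
  have q: "\<kappa> * real (L p) * x \<le> real q" using k_bounds(3) by (simp add: x_def q_def)
  have two: "(1 :: real) \<le> 2 ^ m" by (rule one_le_power) simp
  have wx2: "w \<le> x\<^sup>2"
  proof -
    have "w \<le> (2 ^ m) powr (-(1 + \<delta>) + -(1 + \<delta>))"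
      unfolding w_def using two alpha_delta(1) by (intro powr_mono) auto
    then show ?thesis by (simp only: powr_add x_def power2_eq_square)
  qed
  have x1: "x \<le> 1"
  proof -
    have "x \<le> (2 ^ m) powr 0" unfolding x_def using two delta_pos by (intro powr_mono) auto
    then show ?thesis by simp
  qed
  \<comment> \<open>The leading term. Enlarging \<open>C\<close> raises the numerator linearly but
    the lower bound for the denominator quadratically.\<close>
  have t1: "real (L p) * w * 2 ^ p / (real q)\<^sup>2 \<le> 1 / (\<kappa>\<^sup>2 * C)"
  proof -
    have "real (L p) * w * 2 ^ p / (real q)\<^sup>2 \<le> real (L p) * x\<^sup>2 * 2 ^ p / (\<kappa> * real (L p) * x)\<^sup>2"
      using q pos kappa_pos wx2 by (intro frac_le mult_right_mono mult_left_mono power_mono) auto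
    also have "\<dots> = 2 ^ p / (\<kappa>\<^sup>2 * real (L p))" using pos kappa_pos by (simp add: field_simps power2_eq_square)
    also have "\<dots> = 1 / (\<kappa>\<^sup>2 * C)" unfolding L_pos(2) by simp
    finally show ?thesis .
  qed
  \<comment> \<open>This term stems from the summand \<open>q\<close> in the second binomial
    coefficient; a fine time grid makes it small.\<close>
  have t2: "real (L p) * w / (real D * real q) \<le> 1 / (\<kappa> * D)"
  proof -
    have "x * x \<le> x * 1" using x1 pos by (intro mult_left_mono) auto
    then have "w \<le> x" using wx2 by (simp add: power2_eq_square)
    then have "real (L p) * w / (real D * real q) \<le> real (L p) * x / (real D * (\<kappa> * real (L p) * x))"
      using q pos kappa_pos by (intro frac_le mult_left_mono) auto
    also have "\<dots> = 1 / (\<kappa> * D)" using pos kappa_pos by (simp add: field_simps)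
    finally show ?thesis .
  qed
  have kap: "1 / \<kappa> = 8 / (1 - 2 powr (- (\<alpha> - 2) / 4))"
    unfolding \<kappa>_def \<delta>_def minus_divide_left by simp
  have b1: "4 * exp 2 * (1 / (\<kappa>\<^sup>2 * C)) \<le> 1 / 4"
  proof -
    have "16 * exp 2 * (1 / \<kappa>)\<^sup>2 \<le> real C" unfolding kap by (rule C_large(2))
    then show ?thesis using C_large(1) kappa_pos by (simp add: field_simps power_one_over)
  qed
  have b2: "4 * exp 2 * (1 / (\<kappa> * D)) \<le> 1 / 4"
  proof -
    have "16 * exp 2 * (1 / \<kappa>) \<le> real D" unfolding kap using D_large(2) by simp
    then show ?thesis using D_large(1) kappa_pos by (simp add: field_simps)
  qed
  have "P.prob (chains p m) \<le> real ((2 * L p) choose q) * real ((2 ^ p * D + q) choose q) * (2 * w / real D) ^ q"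
    unfolding q_def w_def by (rule P.chain_event_prob) (use D_large in auto)
  also have "\<dots> \<le> (exp 1 * real (2 * L p) / real q) ^ q * (exp 1 * real (2 ^ p * D + q) / real q) ^ q * (2 * w / real D) ^ q"
    using pos by (intro mult_right_mono mult_mono binomial_le_exp) auto
  also have "\<dots> = (4 * exp 2 * (real (L p) * w * 2 ^ p / (real q)\<^sup>2 + real (L p) * w / (real D * real q))) ^ q"
  proof -
    have "exp 1 * real (2 * L p) / real q * (exp 1 * real (2 ^ p * D + q) / real q) * (2 * w / real D)
      = 4 * exp 2 * (real (L p) * w * 2 ^ p / (real q)\<^sup>2 + real (L p) * w / (real D * real q))"
    proof -
      have "exp (2 :: real) = exp 1 * exp 1" by (simp flip: exp_add)
      then show ?thesis using pos by (simp add: field_simps power2_eq_square)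
    qed
    then show ?thesis by (simp only: power_mult_distrib[symmetric])
  qed
  also have "\<dots> \<le> (1 / 2) ^ q"
  proof (rule power_mono)
    have "4 * exp 2 * (real (L p) * w * 2 ^ p / (real q)\<^sup>2 + real (L p) * w / (real D * real q))
        \<le> 4 * exp 2 * (1 / (\<kappa>\<^sup>2 * C) + 1 / (\<kappa> * D))"
      using t1 t2 by (intro mult_left_mono add_mono) auto
    also have "\<dots> \<le> 1 / 2" using b1 b2 unfolding distrib_left by linarith
    finally show "4 * exp 2 * (real (L p) * w * 2 ^ p / (real q)\<^sup>2 + real (L p) * w / (real D * real q)) \<le> 1 / 2" .
  qed (use pos in auto)
  \<comment> \<open>This crude bound suffices, because the lower bound for \<open>q\<close> grows
    geometrically in \<open>p\<close>, uniformly in \<open>m \<le> M p\<close>.\<close>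
  also have "\<dots> \<le> 1 / real q" by (rule inverse_power_two_le[OF pos(4)])
  also have "\<dots> \<le> 1 / (\<kappa> * real (L p) * x)"
    using q pos kappa_pos by (intro divide_left_mono) auto
  also have "\<dots> = 1 / (\<kappa> * C) * ((2 ^ m) powr (1 + \<delta>) / 2 ^ p)"
  proof -
    have "x = 1 / (2 ^ m) powr (1 + \<delta>)" unfolding x_def by (rule powr_minus_divide)
    then have "(2 ^ m) powr (1 + \<delta>) = 1 / x" by simp
    then show ?thesis unfolding L_pos(2) by simp
  qed
  also have "\<dots> \<le> 1 / (\<kappa> * C) * ((2 powr (\<beta> * real p)) powr (1 + \<delta>) / 2 ^ p)"
    using M_bounds(3)[OF m] delta_pos kappa_pos
    by (intro mult_left_mono divide_right_mono powr_mono2) auto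
  also have "(2 powr (\<beta> * real p)) powr (1 + \<delta>) / 2 ^ p = (2 powr (\<beta> * (1 + \<delta>) - 1)) ^ p"
  proof -
    have "(2 powr (\<beta> * (1 + \<delta>) - 1)) ^ p = 2 powr ((\<beta> * (1 + \<delta>) - 1) * real p)"
      by (simp add: powr_powr[symmetric] powr_realpow)
    also have "(\<beta> * (1 + \<delta>) - 1) * real p = \<beta> * real p * (1 + \<delta>) - real p" by (simp add: algebra_simps)
    also have "2 powr \<dots> = (2 powr (\<beta> * real p)) powr (1 + \<delta>) / 2 ^ p"
      by (simp only: powr_diff powr_powr powr_realpow zero_less_numeral)
    finally show ?thesis by simp
  qed
  finally show ?thesis .
qed

abbreviation paths :: "nat \<Rightarrow> 'w set" where
  "paths p \<equiv> P.path_event \<alpha> D (2 ^ p * D) (L p) (s p)"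

text \<open>The choice \<open>r = 16 * c1\<close> gives \<open>r * s p = 4 * L p\<close>. One
  \<open>L p\<close> each pays for the values of the path in the path count, for the weights of
  newly passed shells, for the terms proportional to time together with the constant 2, and for the
  final decay in \<open>p\<close>.\<close>

lemma paths_prob: "P.prob (paths p) \<le> (1 / 2) ^ p"
proof -
  define r where "r = 16 * c1"
  define K where "K = r * exp (r * tail \<alpha> 0)"
  define z where "z = (\<Sum>d. real d powr (1 - \<alpha>))"
  have K: "0 \<le> K" using c1 by (simp add: K_def r_def)
  have z: "0 \<le> z" unfolding z_def by (intro suminf_nonneg) (use alpha in \<open>auto simp: summable_real_powr_iff\<close>)
  have "P.prob (paths p) \<le> 2 ^ (2 ^ p * D + L p + 2) *
      exp (2 / real D * K * (real (2 ^ p * D) * z + real (L p) * tail \<alpha> 0) - r * s p)"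
    unfolding K_def z_def by (rule P.path_event_prob[OF alpha D_large(1)]) (use c1 in \<open>simp add: r_def\<close>)
  also have "(2 :: real) ^ (2 ^ p * D + L p + 2) \<le> exp (real (2 ^ p * D + L p + 2))"
  proof -
    have "(2 :: real) ^ (2 ^ p * D + L p + 2) \<le> exp 1 ^ (2 ^ p * D + L p + 2)"
      using exp_ge_add_one_self[of 1] by (intro power_mono) auto
    then show ?thesis by (simp only: exp_of_nat_mult[symmetric] mult_1_right)
  qed
  also have "exp (real (2 ^ p * D + L p + 2)) *
      exp (2 / real D * K * (real (2 ^ p * D) * z + real (L p) * tail \<alpha> 0) - r * s p)
    = exp (real (2 ^ p * D + L p + 2) + (2 / real D * K * (real (2 ^ p * D) * z + real (L p) * tail \<alpha> 0) - r * s p))"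
    by (simp add: exp_add)
  also have "\<dots> \<le> exp (- real p)"
  proof (subst exp_le_cancel_iff)
    have rs: "r * s p = 4 * real (L p)" using c1 by (simp add: r_def s_def)
    have e: "2 / real D * K * (real (2 ^ p * D) * z + real (L p) * tail \<alpha> 0)
        = 2 * K * z * 2 ^ p + (2 * K * tail \<alpha> 0 / real D) * real (L p)"
      using D_large(1) by (simp add: field_simps)
    have "2 * K * tail \<alpha> 0 / real D \<le> 1"
      using D_large(1,3) by (simp add: K_def r_def divide_le_eq)
    then have 1: "(2 * K * tail \<alpha> 0 / real D) * real (L p) \<le> real (L p)"
      using mult_right_mono[of "2 * K * tail \<alpha> 0 / real D" 1 "real (L p)"] by simp
    have "(real D + 2 + 2 * K * z) * 2 ^ p \<le> real C * 2 ^ p"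
      using C_large(4) by (intro mult_right_mono) (auto simp: K_def z_def r_def)
    moreover have "2 * (1 :: real) \<le> 2 * 2 ^ p" by (intro mult_left_mono one_le_power) auto
    ultimately have 2: "real D * 2 ^ p + 2 + 2 * K * z * 2 ^ p \<le> real (L p)"
      unfolding L_pos(2) distrib_right by linarith
    have "real p \<le> real (L p)" using L_pos(3)[of p] less_exp[of p]
      by (metis le_less_trans less_imp_le of_nat_less_numeral_power_cancel_iff order_trans)
    then show "real (2 ^ p * D + L p + 2) + (2 / real D * K * (real (2 ^ p * D) * z + real (L p) * tail \<alpha> 0) - r * s p) \<le> - real p"
      unfolding e rs using 1 2 by (simp add: mult.commute)
  qed
  also have "exp (- real p) = exp (- 1) ^ p" by (simp flip: exp_of_nat_mult)
  also have "\<dots> \<le> (1 / 2) ^ p"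
  proof (rule power_mono)
    show "exp (- 1) \<le> (1 / 2 :: real)" using exp_ge_add_one_self[of 1] by (simp add: exp_minus field_simps)
  qed auto
  finally show ?thesis by simp
qed

definition bad_event :: "nat \<Rightarrow> 'w set" where
  "bad_event p = big_event p \<union> (\<Union>m\<le>M p. chains p m) \<union> paths p"

lemma chains_events: "chains p m \<in> P.events"
  by (rule P.chain_event_prob(1)[OF D_large(1)]) simp

lemma paths_events: "paths p \<in> P.events"
  by (rule P.path_event_prob(1)[OF alpha D_large(1) order_refl])

lemma bad_event_events: "bad_event p \<in> P.events"
  unfolding bad_event_def
  by (intro sets.Un paths_events big_event_prob(1) sets.finite_UN[OF finite_atMost chains_events])

text \<open>At most \<open>p + 1\<close> values of \<open>m\<close> occur at scale \<open>p\<close>;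
  the linear factor is absorbed by the differentiated geometric series.\<close>

lemma bad_event_summable: "summable (\<lambda>p. P.prob (bad_event p))"
proof -
  define b where "b p = (4 * (C + 1) * (2 powr (2 - \<alpha> * \<beta>)) ^ p +
     2 * (\<Sum>d. real d powr -(1 + \<delta>)) * (2 powr (1 - \<beta> * (\<alpha> - 1 - \<delta>))) ^ p)
     + 1 / (\<kappa> * C) * (real (Suc p) * (2 powr (\<beta> * (1 + \<delta>) - 1)) ^ p) + (1 / 2) ^ p" for p
  have lt1: "2 powr e < 1" if "e < 0" for e :: real
    using powr_less_mono[of e 0 2] that by simp
  have "summable b"
    unfolding b_def using beta_bounds
    by (intro summable_add summable_mult summable_geometric sums_summable[OF geometric_deriv_sums])
      (auto intro!: lt1)
  moreover have "P.prob (bad_event p) \<le> b p" for p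
  proof -
    have ev: "big_event p \<in> P.events" "(\<Union>m\<le>M p. chains p m) \<in> P.events" "paths p \<in> P.events"
      by (rule big_event_prob(1), rule sets.finite_UN[OF finite_atMost chains_events], rule paths_events)
    have "P.prob (bad_event p) \<le> P.prob (big_event p \<union> (\<Union>m\<le>M p. chains p m)) + P.prob (paths p)"
      unfolding bad_event_def by (rule measure_Un_le) (use ev in auto)
    also have "P.prob (big_event p \<union> (\<Union>m\<le>M p. chains p m)) \<le> P.prob (big_event p) + P.prob (\<Union>m\<le>M p. chains p m)"
      by (rule measure_Un_le) (use ev in auto)
    also have "P.prob (\<Union>m\<le>M p. chains p m) \<le> (\<Sum>m\<le>M p. P.prob (chains p m))"
      using chains_events by (intro P.finite_measure_subadditive_finite) auto
    also have "\<dots> \<le> (\<Sum>m\<le>M p. 1 / (\<kappa> * C) * (2 powr (\<beta> * (1 + \<delta>) - 1)) ^ p)"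
      by (intro sum_mono chains_prob) auto
    also have "\<dots> = real (Suc (M p)) * (1 / (\<kappa> * C) * (2 powr (\<beta> * (1 + \<delta>) - 1)) ^ p)" by simp
    also have "\<dots> \<le> real (Suc p) * (1 / (\<kappa> * C) * (2 powr (\<beta> * (1 + \<delta>) - 1)) ^ p)"
      using M_bounds(4)[of p] kappa_pos by (intro mult_right_mono) auto
    also have "\<dots> = 1 / (\<kappa> * C) * (real (Suc p) * (2 powr (\<beta> * (1 + \<delta>) - 1)) ^ p)" by simp
    finally show ?thesis using big_event_prob(2)[of p] paths_prob[of p] unfolding b_def by linarith
  qed
  ultimately show ?thesis by - (rule summable_comparison_test'[where g = b and N = 0], simp_all)
qed

lemma AE_not_bad: "AE \<omega> in M'. \<forall>\<^sub>F p in sequentially. \<omega> \<in> space M' - bad_event p"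
  by (rule borel_cantelli_AE1)
    (use bad_event_events bad_event_summable in \<open>auto simp: P.emeasure_eq_measure\<close>)

end

section \<open>Choice of the constants, almost sure properties of the paths, and passage to all
  times\<close>

lemma constants_exist:
  assumes "\<alpha> > 2" "c1 > 0"
  shows "\<exists>\<beta> D C. constants \<alpha> c1 \<beta> D C"
proof -
  \<comment> \<open>This is equivalent to \<open>\<alpha> > 2\<close>. Below, \<open>D\<close> is
    fixed before \<open>C\<close>, whose lower bound involves it.\<close>
  have "2 / \<alpha> < 4 / (\<alpha> + 2)" using assms by (simp add: field_simps)
  then obtain \<beta> where "2 / \<alpha> < \<beta>" "\<beta> < 4 / (\<alpha> + 2)" using dense by blast
  moreover obtain D :: nat where "max 1 (max (16 * exp 2 * 8 / (1 - 2 powr (- (\<alpha> - 2) / 4)))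
      (2 * (16 * c1 * exp (16 * c1 * tail \<alpha> 0)) * tail \<alpha> 0)) \<le> real D"
    using real_arch_simple by blast
  moreover obtain C :: nat where "max 2 (max (16 * exp 2 * (8 / (1 - 2 powr (- (\<alpha> - 2) / 4)))\<^sup>2)
      (max (2 * c1 * tail \<alpha> 0)
        (real D + 2 + 2 * (16 * c1 * exp (16 * c1 * tail \<alpha> 0)) * (\<Sum>d. real d powr (1 - \<alpha>))))) \<le> real C"
    using real_arch_simple by blast
  ultimately have "constants \<alpha> c1 \<beta> D C" using assms by unfold_locales auto
  then show ?thesis by blast
qed

text \<open>Points whose block indices differ by \<open>d\<close> are at distance at least
  \<open>d - 1\<close>, and \<open>1 + (d - 1)\<^sup>2 \<ge> d\<^sup>2 / 2\<close> because
  \<open>(d - 2)\<^sup>2 \<ge> 0\<close>. The factor \<open>2 powr \<alpha>\<close> comes from this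
  halving, which also covers adjacent shells.\<close>

lemma dispersal_kernel_far:
  assumes "0 < c" "0 < \<alpha>" "blk y < blk x"
  shows "dispersal_kernel c \<alpha> (x - y) \<le> c * 2 powr \<alpha> * real (blk x - blk y) powr (-2 * \<alpha>)"
proof -
  define d where "d = real (blk x - blk y)"
  have d: "1 \<le> d" "d = real (blk x) - real (blk y)" using assms(3) by (auto simp: d_def of_nat_diff)
  have "d - 1 \<le> \<bar>x - y\<bar>" using blk_bounds(1)[of x] blk_bounds(2)[of y] d by linarith
  then have "(d - 1)\<^sup>2 \<le> \<bar>x - y\<bar>\<^sup>2" using d by (intro power_mono) auto
  moreover have "d\<^sup>2 / 2 \<le> 1 + (d - 1)\<^sup>2"
    using zero_le_power2[of "d - 2"] by (simp add: power2_eq_square algebra_simps)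
  ultimately have "d\<^sup>2 / 2 \<le> 1 + \<bar>x - y\<bar>\<^sup>2" by linarith
  then have "(d\<^sup>2 / 2) powr \<alpha> \<le> (1 + \<bar>x - y\<bar>\<^sup>2) powr \<alpha>"
    using assms d by (intro powr_mono2) auto
  then have "dispersal_kernel c \<alpha> (x - y) \<le> c / (d\<^sup>2 / 2) powr \<alpha>"
    unfolding dispersal_kernel_def
  proof (rule divide_left_mono)
    have "0 < d\<^sup>2 / 2" "0 < 1 + \<bar>x - y\<bar>\<^sup>2" using d(1) by (auto intro: add_pos_nonneg)
    then show "0 < (1 + \<bar>x - y\<bar>\<^sup>2) powr \<alpha> * (d\<^sup>2 / 2) powr \<alpha>" by (intro mult_pos_pos powr_gt_zero[THEN iffD2]) auto
  qed (use assms in auto)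
  also have "(d\<^sup>2 / 2) powr \<alpha> = (d powr 2) powr \<alpha> / 2 powr \<alpha>"
    using d by (simp add: powr_divide)
  also have "c / \<dots> = c * 2 powr \<alpha> * d powr (-2 * \<alpha>)"
    by (simp add: powr_powr powr_minus_divide)
  finally show ?thesis by (simp add: d_def)
qed

text \<open>Rational times, rational balls and shells are countably many, so the null sets of the
  single equations can be united.\<close>

lemma AE_front_path:
  assumes "2 < \<alpha>" "0 < c"
    and B: "birth_process M (birth_rate (dispersal_kernel c \<alpha>)) N \<eta>"
    and start: "AE \<omega> in M. \<eta> 0 \<omega> = {0}"
  shows "AE \<omega> in M. front_path (N \<omega>) (\<lambda>t. \<eta> t \<omega>) (dispersal_kernel c \<alpha>) \<alpha> (c * 2 powr \<alpha>)"
proof -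
  let ?a = "dispersal_kernel c \<alpha>"
  interpret P: poisson_points M N
    using B by unfold_locales (simp add: birth_process_def ambient_def)
  have fin: "finite (\<eta> t \<omega>)" if "0 \<le> t" "\<omega> \<in> space M" for t \<omega>
    using B that by (simp add: birth_process_def)
  have bal: "AE \<omega> in M. balance (N \<omega>) ?a (\<lambda>t. \<eta> t \<omega>) t B" if "0 \<le> t" "B \<in> sets borel" "bounded B" for t B
    using B that unfolding birth_process_def balance_def by blast
  define Q where "Q = {q \<in> \<rat>. (0 :: real) \<le> q}"
  have cQ: "countable Q" "countable (\<rat> :: real set)"
    using countable_rat by (auto simp: Q_def intro: countable_subset[of _ \<rat>])
  have "AE \<omega> in M. \<forall>q\<in>Q. \<forall>y\<in>\<rat>. \<forall>e\<in>\<rat>. balance (N \<omega>) ?a (\<lambda>t. \<eta> t \<omega>) q (ball y e)"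
    using cQ by (intro AE_ball_countable' bal) (auto simp: Q_def)
  moreover have "AE \<omega> in M. \<forall>q\<in>Q. \<forall>i. balance (N \<omega>) ?a (\<lambda>t. \<eta> t \<omega>) q (shell i)"
    unfolding AE_all_countable using cQ
    by (intro AE_ball_countable' AE_all_countable[THEN iffD2] allI bal) (auto simp: Q_def bounded_shell)
  moreover have "AE \<omega> in M. \<forall>n i. emeasure (N \<omega>) (slab 0 (real n) i 1) < \<infinity>"
    using measure_slab(2)[of 0 _ 1]
    by (intro AE_all_countable[THEN iffD2] allI P.AE_finite_N) (auto intro: slab_sets)
  moreover have "AE \<omega> in M. cadlag finite_config_topology (\<lambda>t. \<eta> t \<omega>)"
    using B by (simp add: birth_process_def)
  ultimately show ?thesis using start AE_space
  proof eventually_elim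
    case (elim \<omega>)
    show ?case
    proof unfold_locales
      show "sets (N \<omega>) = sets ambient" using P.sets_N elim(6) .
      show "emeasure (N \<omega>) A \<in> range ennreal_of_enat" if "A \<in> sets ambient" for A
        using P.enat_N[OF elim(6) that] .
      show "?a \<in> borel_measurable borel" unfolding dispersal_kernel_def by measurable
      show "0 \<le> ?a z" for z using assms(2) by (simp add: dispersal_kernel_def)
      show "?a (x - y) \<le> c * 2 powr \<alpha> * real (blk x - blk y) powr (-2 * \<alpha>)" if "blk y < blk x" for x y
        using assms that by (intro dispersal_kernel_far) auto
    qed (use elim fin assms in \<open>auto simp: Q_def\<close>)
  qed
qed

context scales
begin

text \<open>Outside \<open>bad_event p\<close> the three conditions of \<open>front_less\<close>
  hold with \<open>T = 2 ^ p\<close>.\<close>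

lemma front_less_scale:
  assumes F: "front_path (N \<omega>) h a \<alpha> c1" and good: "\<omega> \<in> space M' - bad_event p"
    and y: "y \<in> h (2 ^ p)"
  shows "\<bar>y\<bar> \<le> real (L p)"
proof -
  interpret F: front_path "N \<omega>" h a \<alpha> c1 by (rule F)
  have "F.front (real (2 ^ p)) < L p"
  proof (rule F.front_less[where D = D and M = "M p" and k = "k p" and S = "s p"])
    show "emeasure (N \<omega>) (slab 0 (real (2 ^ p)) v (max (2 ^ Suc (M p)) (real (v - L p)) powr -\<alpha>)) = 0" for v
      using good by (auto simp: bad_event_def big_event_def)
    show "\<exists>v\<in>S. emeasure (N \<omega>) (cell D (f v) v ((2 ^ m) powr -\<alpha>)) = 0"
      if "m \<le> M p" "S \<subseteq> {..<2 * L p}" "card S = k p m" "mono_on S f" "f ` S \<subseteq> {..<2 ^ p * D}" for m S f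
    proof -
      have "\<omega> \<notin> chains p m" using good that(1) by (auto simp: bad_event_def)
      then show ?thesis using that good unfolding P.chain_event_def by blast
    qed
    show "(\<Sum>n<2 ^ p * D. \<Sum>i\<le>j (Suc n). enn2real (emeasure (N \<omega>) (cell D n i 1)) * tail \<alpha> (j n - i)) < s p"
      if "mono_on {..2 ^ p * D} j" "j ` {..2 ^ p * D} \<subseteq> {..L p}" for j
    proof -
      have "\<omega> \<notin> paths p" using good by (auto simp: bad_event_def)
      then have "\<not> s p \<le> P.path_weight \<omega> \<alpha> D (2 ^ p * D) j"
        using that good unfolding P.path_event_def by blast
      then show ?thesis by (simp add: P.path_weight_def)
    qed
  qed (use D_large(1) M_bounds(1) k_bounds(1) total_bound in auto)
  moreover have "blk y \<le> F.front (real (2 ^ p))" using y by (intro F.blk_le_front) auto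
  ultimately have "real (blk y) + 1 \<le> real (L p)" by linarith
  then show ?thesis using blk_bounds(2)[of y] by linarith
qed

end

theorem theorem2p1:
  fixes \<alpha> c :: real
  assumes "\<alpha> > 2"
    and "c > 0"
    and "has_bochner_integral lborel (dispersal_kernel c \<alpha>) 1"
  shows "\<exists>C>0. \<forall>(M :: 'w measure) N \<eta>.
           birth_process M (birth_rate (dispersal_kernel c \<alpha>)) N \<eta> \<longrightarrow>
           (AE \<omega> in M. \<eta> 0 \<omega> = {0}) \<longrightarrow>
           (AE \<omega> in M. \<forall>\<^sub>F t in at_top. \<eta> t \<omega> \<subseteq> {- C * t..C * t})"
proof -
  let ?a = "dispersal_kernel c \<alpha>" and ?c1 = "c * 2 powr \<alpha>"
  have "0 < ?c1" using assms by simp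
  then obtain \<beta> D C where K: "constants \<alpha> ?c1 \<beta> D C"
    using constants_exist assms(1) by blast
  then interpret K: constants \<alpha> ?c1 \<beta> D C .
  show ?thesis
  \<comment> \<open>The constants are fixed before the process is given. The factor 2 pays for
    rounding times up to the next power of two.\<close>
  proof (intro exI[of _ "2 * real C"] conjI allI impI)
    show "0 < 2 * real C" using K.C_large(1) by simp
    fix M :: "'w measure" and N \<eta>
    assume B: "birth_process M (birth_rate ?a) N \<eta>" and start: "AE \<omega> in M. \<eta> 0 \<omega> = {0}"
    interpret S: scales \<alpha> ?c1 \<beta> D C M N
      using B by unfold_locales (simp add: birth_process_def ambient_def)
    show "AE \<omega> in M. \<forall>\<^sub>F t in at_top. \<eta> t \<omega> \<subseteq> {- (2 * real C) * t..2 * real C * t}"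
      using AE_front_path[OF assms(1,2) B start] S.AE_not_bad
    proof eventually_elim
      case (elim \<omega>)
      interpret F: front_path "N \<omega>" "\<lambda>t. \<eta> t \<omega>" ?a \<alpha> ?c1 by (rule elim(1))
      obtain p0 where p0: "\<And>p. p0 \<le> p \<Longrightarrow> \<omega> \<in> space M - S.bad_event p"
        using elim(2) unfolding eventually_sequentially by blast
      have "\<eta> t \<omega> \<subseteq> {- (2 * real C) * t..2 * real C * t}" if t: "2 ^ p0 \<le> t" for t
      proof
        fix y assume y: "y \<in> \<eta> t \<omega>"
        have t1: "1 \<le> t" using t one_le_power[of "2 :: real" p0] by linarith
        \<comment> \<open>Particles present at \<open>t\<close> are still present at
          \<open>2 ^ Suc p\<close>, which is at most \<open>2 * t\<close>.\<close>
        then obtain p where p: "2 ^ p \<le> nat \<lfloor>t\<rfloor>" "nat \<lfloor>t\<rfloor> < 2 ^ Suc p"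
          using ex_power_ivl1[of 2 "nat \<lfloor>t\<rfloor>"] by (auto simp: le_nat_iff)
        have ft: "real (nat \<lfloor>t\<rfloor>) = of_int \<lfloor>t\<rfloor>" using t1 by simp
        have pt: "2 ^ p \<le> t"
        proof -
          have "real (2 ^ p) \<le> real (nat \<lfloor>t\<rfloor>)" using p(1) by (simp only: of_nat_le_iff)
          then have "real (2 ^ p) \<le> t" unfolding ft by linarith
          then show ?thesis by simp
        qed
        have tp: "t \<le> 2 ^ Suc p"
        proof -
          have "real (nat \<lfloor>t\<rfloor>) + 1 \<le> real (2 ^ Suc p)" using p(2) by linarith
          then have "t \<le> real (2 ^ Suc p)" unfolding ft by linarith
          then show ?thesis by simp
        qed
        have "(2 :: real) ^ p0 \<le> 2 ^ Suc p" using t tp by linarith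
        then have "p0 \<le> Suc p" by (simp only: power_increasing_iff one_less_numeral_iff semiring_norm)
        moreover have "y \<in> \<eta> (2 ^ Suc p) \<omega>" using F.mono[of t "2 ^ Suc p"] t1 tp y by auto
        ultimately have "\<bar>y\<bar> \<le> real (K.L (Suc p))"
          using S.front_less_scale[OF elim(1) p0] by blast
        also have "\<dots> = 2 * real C * 2 ^ p" by (simp add: K.L_pos(2))
        also have "\<dots> \<le> 2 * real C * t" using pt by (intro mult_left_mono) auto
        finally show "y \<in> {- (2 * real C) * t..2 * real C * t}" by auto
      qed
      then show ?case unfolding eventually_at_top_linorder by blast
    qed
  qed
qed

end
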